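(* Let $V$ be a finite-dimensional vector space over a field $\mathbb{K}$, and let $A$ and $B$ be extensors in $\Lambda(V)$, with corresponding subspaces $\overline{A},\overline{B}\subseteq V$. (1) Let $p=\dim\overline{A}-\dim(\overline{A}\cap\overline{B})=\dim(\overline{A}+\overline{B})-\dim\overline{B}$, and let $0\le h\le p$. Then: - the left span of the tensor $\diamond^{(h)}_{21}(A\otimes B)$ equals the linear span of all extensors $H$ such that $\overline{A}\cap\overline{B}\subseteq\overline{H}\subseteq\overline{A}$ and $\overline{H}$ has codimension $h$ in $\overline{A}$; - the right span of the tensor $\diamond^{(h)}_{21}(A\otimes B)$ equals the linear span of all extensors $K$ such that $\overline{B}\subseteq\overline{K}\subseteq\overline{A}+\overline{B}$ and $\dim\overline{K}=\dim\overline{B}+h$. (2) Let $p'=\dim\overline{B}-\dim(\overline{A}\cap\overline{B})$, and let $0\le h\le p'$. Then: - the left span of $\diamond^{(h)}_{12}(A\otimes B)$ equals the linear span of all extensors $K$ such that $\overline{A}\subseteq\overline{K}\subseteq\overline{A}+\overline{B}$ and $\dim\overline{K}=\dim\overline{A}+h$; - the right span of $\diamond^{(h)}_{12}(A\otimes B)$ equals the linear span of all extensors $H$ such that $\overline{A}\cap\overline{B}\subseteq\overline{H}\subseteq\overline{B}$ and $\overline{H}$ has codimension $h$ in $\overline{B}$.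
   Context: $\Lambda(V)$ is the exterior algebra of $V$; its product is written by juxtaposition. An extensor of step $k$ is a nonzero element $A\in\Lambda(V)$ that can be written as a product $v_1v_2\cdots v_k$ of $k$ vectors of $V$ (for $k=0$: a nonzero scalar); then $\overline{A}$ denotes the $k$-dimensional subspace spanned by $v_1,\dots,v_k$, which depends only on $A$. For an extensor $A=v_1\cdots v_a$ and integers $i,j\ge 0$ with $i+j=a$, the coproduct slice is $$\sum_{(A)_{(i,j)}}A_{(1)}\otimes A_{(2)}=\sum_{I}\operatorname{sgn}(I,J)\;v_I\otimes v_J\in\Lambda(V)\otimes\Lambda(V),$$ where $I$ runs over the $i$-element subsets of $\{1,\dots,a\}$, $J$ is the complement of $I$, $v_I$ and $v_J$ are the products of the corresponding vectors in increasing order of index, and $\operatorname{sgn}(I,J)$ is the sign of the permutation listing $I$ increasingly followed by $J$ increasingly. It is the $(i,j)$-homogeneous component of the usual coproduct of $\Lambda(V)$ and depends only on $A$. If $i<0$ or $j<0$ the slice is $0$. For an integer $h\ge 0$, the geometric products $\diamond^{(h)}_{21},\diamond^{(h)}_{12}:\Lambda(V)\otimes\Lambda(V)\to\Lambda(V)\otimes\Lambda(V)$ are the linear operators defined, for extensors $A,B$ of steps $a,b$, by $$\diamond^{(h)}_{21}(A\otimes B)=\sum_{(A)_{(a-h,h)}}A_{(1)}\otimes A_{(2)}B,\qquad \diamond^{(h)}_{12}(A\otimes B)=\sum_{(B)_{(h,b-h)}}AB_{(1)}\otimes B_{(2)}.$$ For a tensor $t$ in a tensor product $X\otimes Y$ of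 vector spaces, the left span of a representation $t=\sum_{i=1}^r x_i\otimes y_i$ is the subspace of $X$ spanned by $x_1,\dots,x_r$, and the left span of $t$ is the intersection of the left spans of all representations of $t$. The right span of $t$ (a subspace of $Y$) is defined symmetrically. *)

theory Defs
  imports Complex_Main "HOL-Library.Poly_Mapping" "HOL-Combinatorics.Permutations"
begin

section \<open>Vector spaces given by generators and relations\<close>

text \<open>
  The free vector space over the field \<open>'k\<close> on the set of all elements of \<open>'g\<close> is \<open>'g \<Rightarrow>\<^sub>0 'k\<close>.
  The predicate \<open>presented_by\<close> says that the linear extension of \<open>f\<close> to the free vector space is
  onto and that its kernel is the linear span of \<open>R\<close>; in other words, \<open>f\<close> identifies the space
  with the quotient of the free vector space by the span of \<open>R\<close>. Quotients are described up to
  isomorphism in this way because a HOL type cannot depend on the scalar multiplication of \<open>V\<close>.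
\<close>

definition free_scale :: "'k::field \<Rightarrow> ('g \<Rightarrow>\<^sub>0 'k) \<Rightarrow> ('g \<Rightarrow>\<^sub>0 'k)" where
  "free_scale c p = Poly_Mapping.map ((*) c) p"

definition lin_extend ::
  "('k::field \<Rightarrow> 'w \<Rightarrow> 'w) \<Rightarrow> ('g \<Rightarrow> 'w) \<Rightarrow> ('g \<Rightarrow>\<^sub>0 'k) \<Rightarrow> 'w::ab_group_add" where
  "lin_extend scaleW f p = (\<Sum>g\<in>Poly_Mapping.keys p. scaleW (Poly_Mapping.lookup p g) (f g))"

definition presented_by ::
  "('k::field \<Rightarrow> 'w \<Rightarrow> 'w) \<Rightarrow> ('g \<Rightarrow> 'w::ab_group_add) \<Rightarrow> ('g \<Rightarrow>\<^sub>0 'k) set \<Rightarrow> bool" where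
  "presented_by scaleW f R \<longleftrightarrow>
     (\<forall>w. \<exists>p. lin_extend scaleW f p = w) \<and>
     {p. lin_extend scaleW f p = 0} = module.span free_scale R"

lemma lookup_free_scale: "Poly_Mapping.lookup (free_scale c p) g = c * Poly_Mapping.lookup p g"
  by (auto simp: free_scale_def Poly_Mapping.map.rep_eq when_def)

interpretation free: vector_space free_scale
  by unfold_locales
    (auto simp: poly_mapping_eq_iff fun_eq_iff lookup_add lookup_free_scale algebra_simps)

context vector_space
begin

lemma lin_extend_superset:
  assumes "finite S" "Poly_Mapping.keys p \<subseteq> S"
  shows "lin_extend scale f p = (\<Sum>g\<in>S. scale (Poly_Mapping.lookup p g) (f g))"
  unfolding lin_extend_def using assms
  by (intro sum.mono_neutral_left) (auto simp: in_keys_iff)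

lemma lin_extend_single [simp]: "lin_extend scale f (Poly_Mapping.single g c) = scale c (f g)"
  by (subst lin_extend_superset[of "{g}"]) auto

lemma linear_lin_extend: "Vector_Spaces.linear free_scale scale (lin_extend scale f)"
proof -
  have "lin_extend scale f (p + q) = lin_extend scale f p + lin_extend scale f q" for p q
  proof -
    let ?S = "Poly_Mapping.keys p \<union> Poly_Mapping.keys q"
    have "Poly_Mapping.keys (p + q) \<subseteq> ?S"
      by (rule Poly_Mapping.keys_add)
    then show ?thesis
      by (simp add: lin_extend_superset[of ?S] lookup_add scale_left_distrib sum.distrib)
  qed
  moreover have "lin_extend scale f (free_scale c p) = scale c (lin_extend scale f p)" for c p
  proof -
    have "Poly_Mapping.keys (free_scale c p) \<subseteq> Poly_Mapping.keys p"
      by (auto simp: in_keys_iff lookup_free_scale)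
    then show ?thesis
      by (simp add: lin_extend_superset[of "Poly_Mapping.keys p"] lookup_free_scale scale_sum_right)
  qed
  ultimately show ?thesis
    by unfold_locales auto
qed

end

lemma presented_by_universal:
  assumes W: "vector_space scaleW" and U: "vector_space scaleU"
    and pres: "presented_by scaleW f R"
    and rel: "\<And>r. r \<in> R \<Longrightarrow> lin_extend scaleU g r = 0"
  shows "\<exists>!F. Vector_Spaces.linear scaleW scaleU F \<and> (\<forall>x. F (f x) = g x)"
proof -
  interpret W: vector_space scaleW by (rule W)
  interpret U: vector_space scaleU by (rule U)
  interpret ef: Vector_Spaces.linear free_scale scaleW "lin_extend scaleW f"
    by (rule W.linear_lin_extend)
  interpret eg: Vector_Spaces.linear free_scale scaleU "lin_extend scaleU g"
    by (rule U.linear_lin_extend)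
  define F where "F w = lin_extend scaleU g (SOME p. lin_extend scaleW f p = w)" for w
  have surj: "\<exists>p. lin_extend scaleW f p = w" for w
    using pres by (auto simp: presented_by_def)
  have ker: "lin_extend scaleU g p = 0" if "lin_extend scaleW f p = 0" for p
  proof -
    have "p \<in> free.span R"
      using pres that by (auto simp: presented_by_def)
    then show ?thesis
      using rel eg.eq_0_on_span by blast
  qed
  have F: "F (lin_extend scaleW f p) = lin_extend scaleU g p" for p
  proof -
    define q where "q = (SOME q. lin_extend scaleW f q = lin_extend scaleW f p)"
    have "lin_extend scaleW f q = lin_extend scaleW f p"
      unfolding q_def by (rule someI_ex) blast
    then have "lin_extend scaleU g (q - p) = 0"
      by (intro ker) (simp add: ef.diff)
    then show ?thesis
      by (simp add: F_def q_def eg.diff)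
  qed
  have "Vector_Spaces.linear scaleW scaleU F"
  proof unfold_locales
    show "F (a + b) = F a + F b" for a b
      using surj[of a] surj[of b] F ef.add eg.add by metis
    show "F (scaleW c a) = scaleU c (F a)" for c a
      using surj[of a] F ef.scale eg.scale by metis
  qed
  moreover have "F (f x) = g x" for x
    using F[of "Poly_Mapping.single x 1"] by simp
  moreover have "G = F"
    if G: "Vector_Spaces.linear scaleW scaleU G" and "\<And>x. G (f x) = g x" for G
  proof
    fix w
    interpret G: Vector_Spaces.linear scaleW scaleU G by (rule G)
    obtain p where p: "lin_extend scaleW f p = w"
      using surj by blast
    have "G (lin_extend scaleW f p) = lin_extend scaleU g p"
      unfolding lin_extend_def by (simp add: G.sum G.scale that)
    then show "G w = F w"
      using F p by metis
  qed
  ultimately show ?thesis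
    by blast
qed


section \<open>The exterior algebra\<close>

text \<open>
  The free vector space on \<open>'v list\<close> is the free associative algebra on the set \<open>V\<close>, a list being
  a word in the elements of \<open>V\<close>. The relators below span the two-sided ideal generated by
  \<open>[u + v] - [u] - [v]\<close>, \<open>[c v] - c [v]\<close> and \<open>[v] [v]\<close>, and the quotient by this ideal is
  the tensor algebra of \<open>V\<close> modulo the squares of vectors.
\<close>

definition exterior_relators ::
  "('k::field \<Rightarrow> 'v \<Rightarrow> 'v) \<Rightarrow> ('v::ab_group_add list \<Rightarrow>\<^sub>0 'k) set" where
  "exterior_relators scaleV =
     {Poly_Mapping.single (xs @ [u + v] @ ys) 1 - Poly_Mapping.single (xs @ [u] @ ys) 1
        - Poly_Mapping.single (xs @ [v] @ ys) 1 | xs ys u v. True} \<union>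
     {Poly_Mapping.single (xs @ [scaleV c v] @ ys) 1 - Poly_Mapping.single (xs @ [v] @ ys) c
        | xs ys c v. True} \<union>
     {Poly_Mapping.single (xs @ [v, v] @ ys) 1 | xs ys v. True}"

definition ext_prod :: "('v \<Rightarrow> 'e::ring_1) \<Rightarrow> 'v list \<Rightarrow> 'e" where
  "ext_prod \<iota> vs = prod_list (map \<iota> vs)"

locale exterior_algebra = V: vector_space scaleV + E: vector_space scaleE
  for scaleV :: "'k::field \<Rightarrow> 'v::ab_group_add \<Rightarrow> 'v"
  and scaleE :: "'k \<Rightarrow> 'e::ring_1 \<Rightarrow> 'e"
  and \<iota> :: "'v \<Rightarrow> 'e" +
  assumes scale_mult_left: "scaleE c x * y = scaleE c (x * y)"
    and scale_mult_right: "x * scaleE c y = scaleE c (x * y)"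
    and presented: "presented_by scaleE (ext_prod \<iota>) (exterior_relators scaleV)"

lemma ext_prod_simps [simp]:
  "ext_prod \<iota> [] = 1"
  "ext_prod \<iota> (v # vs) = \<iota> v * ext_prod \<iota> vs"
  "ext_prod \<iota> (xs @ ys) = ext_prod \<iota> xs * ext_prod \<iota> ys"
  by (simp_all add: ext_prod_def)

lemma (in exterior_algebra) relator_zero:
  assumes "r \<in> exterior_relators scaleV"
  shows "lin_extend scaleE (ext_prod \<iota>) r = 0"
  using presented free.span_base[OF assms] unfolding presented_by_def by blast

lemma (in exterior_algebra) linear_\<iota>: "Vector_Spaces.linear scaleV scaleE \<iota>"
proof -
  interpret ev: Vector_Spaces.linear free_scale scaleE "lin_extend scaleE (ext_prod \<iota>)"
    by (rule E.linear_lin_extend)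
  show ?thesis
  proof unfold_locales
    fix u v
    have "Poly_Mapping.single ([] @ [u + v] @ []) 1 - Poly_Mapping.single ([] @ [u] @ []) 1
        - Poly_Mapping.single ([] @ [v] @ []) 1 \<in> exterior_relators scaleV"
      unfolding exterior_relators_def by blast
    from relator_zero[OF this] show "\<iota> (u + v) = \<iota> u + \<iota> v"
      by (simp add: ev.diff diff_eq_eq add.commute)
  next
    fix c v
    have "Poly_Mapping.single ([] @ [scaleV c v] @ []) 1 - Poly_Mapping.single ([] @ [v] @ []) c
        \<in> exterior_relators scaleV"
      unfolding exterior_relators_def by blast
    from relator_zero[OF this] show "\<iota> (scaleV c v) = scaleE c (\<iota> v)"
      by (simp add: ev.diff)
  qed
qed

lemma (in exterior_algebra) \<iota>_square: "\<iota> v * \<iota> v = 0"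
proof -
  have "Poly_Mapping.single ([] @ [v, v] @ []) 1 \<in> exterior_relators scaleV"
    unfolding exterior_relators_def by blast
  from relator_zero[OF this] show ?thesis
    by simp
qed

theorem (in exterior_algebra) universal:
  fixes scaleF :: "'k \<Rightarrow> 'f::ring_1 \<Rightarrow> 'f"
  assumes F: "vector_space scaleF"
    and left: "\<And>c x y. scaleF c x * y = scaleF c (x * y)"
    and right: "\<And>c x y. x * scaleF c y = scaleF c (x * y)"
    and g: "Vector_Spaces.linear scaleV scaleF g"
    and square: "\<And>v. g v * g v = 0"
  shows "\<exists>!\<Phi>. Vector_Spaces.linear scaleE scaleF \<Phi> \<and> \<Phi> 1 = 1 \<and>
              (\<forall>x y. \<Phi> (x * y) = \<Phi> x * \<Phi> y) \<and> (\<forall>v. \<Phi> (\<iota> v) = g v)"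
proof -
  interpret F: vector_space scaleF by (rule F)
  interpret g: Vector_Spaces.linear scaleV scaleF g by (rule g)
  interpret ev: Vector_Spaces.linear free_scale scaleF "lin_extend scaleF (ext_prod g)"
    by (rule F.linear_lin_extend)
  have "lin_extend scaleF (ext_prod g) r = 0" if "r \<in> exterior_relators scaleV" for r
    using that unfolding exterior_relators_def
    by (auto simp: ev.diff g.add g.scale left right distrib_left distrib_right square
          mult.assoc[symmetric])
  from presented_by_universal[OF E.vector_space_axioms F presented this]
  have ex1: "\<exists>!\<Phi>. Vector_Spaces.linear scaleE scaleF \<Phi> \<and>
               (\<forall>vs. \<Phi> (ext_prod \<iota> vs) = ext_prod g vs)" .
  then obtain \<Phi> where lin: "Vector_Spaces.linear scaleE scaleF \<Phi>"
    and \<Phi>: "\<And>vs. \<Phi> (ext_prod \<iota> vs) = ext_prod g vs"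
    by blast
  interpret \<Phi>: Vector_Spaces.linear scaleE scaleF \<Phi> by (rule lin)
  have mult: "\<Phi> (x * y) = \<Phi> x * \<Phi> y" for x y
  proof -
    obtain p q where "x = lin_extend scaleE (ext_prod \<iota>) p" "y = lin_extend scaleE (ext_prod \<iota>) q"
      using presented unfolding presented_by_def by metis
    then show ?thesis
      unfolding lin_extend_def
      by (simp add: sum_product \<Phi>.sum \<Phi>.scale scale_mult_left scale_mult_right left right \<Phi>
            flip: ext_prod_simps(3))
  qed
  have "\<Phi> 1 = 1" "\<Phi> (\<iota> v) = g v" for v
    using \<Phi>[of "[]"] \<Phi>[of "[v]"] by simp_all
  moreover have "\<Psi> = \<Phi>"
    if "Vector_Spaces.linear scaleE scaleF \<Psi>" and "\<Psi> 1 = 1"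
      and "\<And>x y. \<Psi> (x * y) = \<Psi> x * \<Psi> y" and "\<And>v. \<Psi> (\<iota> v) = g v" for \<Psi>
  proof -
    have "\<Psi> (ext_prod \<iota> vs) = ext_prod g vs" for vs
      by (induction vs) (simp_all add: that)
    then show ?thesis
      using ex1 lin \<Phi> that(1) by blast
  qed
  ultimately show ?thesis
    using lin mult by blast
qed

text \<open>
  The scalar \<open>c\<close> matters only for step \<open>0\<close>, where the empty product is \<open>1\<close>; for positive
  step it can be absorbed into one of the vectors.
\<close>

definition extensor_of_step ::
  "('k \<Rightarrow> 'e \<Rightarrow> 'e) \<Rightarrow> ('v \<Rightarrow> 'e::ring_1) \<Rightarrow> nat \<Rightarrow> 'e \<Rightarrow> bool" where
  "extensor_of_step scaleE \<iota> k A \<longleftrightarrow>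
     A \<noteq> 0 \<and> (\<exists>c vs. length vs = k \<and> A = scaleE c (ext_prod \<iota> vs))"

definition extensor :: "('k \<Rightarrow> 'e \<Rightarrow> 'e) \<Rightarrow> ('v \<Rightarrow> 'e::ring_1) \<Rightarrow> 'e \<Rightarrow> bool" where
  "extensor scaleE \<iota> A \<longleftrightarrow> (\<exists>k. extensor_of_step scaleE \<iota> k A)"

definition extensor_space ::
  "('k::field \<Rightarrow> 'v::ab_group_add \<Rightarrow> 'v) \<Rightarrow> ('k \<Rightarrow> 'e \<Rightarrow> 'e) \<Rightarrow> ('v \<Rightarrow> 'e::ring_1) \<Rightarrow> 'e \<Rightarrow> 'v set"
  where
  "extensor_space scaleV scaleE \<iota> A =
     (THE U. \<exists>c vs. A = scaleE c (ext_prod \<iota> vs) \<and> U = module.span scaleV (set vs))"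


section \<open>Tensor products, left and right spans\<close>

definition tensor_relators ::
  "('k::field \<Rightarrow> 'x \<Rightarrow> 'x) \<Rightarrow> ('k \<Rightarrow> 'y \<Rightarrow> 'y) \<Rightarrow>
   ('x::ab_group_add \<times> 'y::ab_group_add \<Rightarrow>\<^sub>0 'k) set" where
  "tensor_relators scaleX scaleY =
     {Poly_Mapping.single (x + x', y) 1 - Poly_Mapping.single (x, y) 1
        - Poly_Mapping.single (x', y) 1 | x x' y. True} \<union>
     {Poly_Mapping.single (x, y + y') 1 - Poly_Mapping.single (x, y) 1
        - Poly_Mapping.single (x, y') 1 | x y y'. True} \<union>
     {Poly_Mapping.single (scaleX c x, y) 1 - Poly_Mapping.single (x, y) c | c x y. True} \<union>
     {Poly_Mapping.single (x, scaleY c y) 1 - Poly_Mapping.single (x, y) c | c x y. True}"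

locale tensor_product =
  X: vector_space scaleX + Y: vector_space scaleY + T: vector_space scaleT
  for scaleX :: "'k::field \<Rightarrow> 'x::ab_group_add \<Rightarrow> 'x"
  and scaleY :: "'k \<Rightarrow> 'y::ab_group_add \<Rightarrow> 'y"
  and scaleT :: "'k \<Rightarrow> 't::ab_group_add \<Rightarrow> 't"
  and tensor :: "'x \<Rightarrow> 'y \<Rightarrow> 't" +
  assumes presented:
    "presented_by scaleT (\<lambda>(x, y). tensor x y) (tensor_relators scaleX scaleY)"

theorem (in tensor_product) universal:
  fixes scaleU :: "'k \<Rightarrow> 'u::ab_group_add \<Rightarrow> 'u"
  assumes U: "vector_space scaleU"
    and lin1: "\<And>y. Vector_Spaces.linear scaleX scaleU (\<lambda>x. \<beta> x y)"
    and lin2: "\<And>x. Vector_Spaces.linear scaleY scaleU (\<beta> x)"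
  shows "\<exists>!\<Phi>. Vector_Spaces.linear scaleT scaleU \<Phi> \<and> (\<forall>x y. \<Phi> (tensor x y) = \<beta> x y)"
proof -
  interpret U: vector_space scaleU by (rule U)
  interpret l1: Vector_Spaces.linear scaleX scaleU "\<lambda>x. \<beta> x y" for y by (rule lin1)
  interpret l2: Vector_Spaces.linear scaleY scaleU "\<beta> x" for x by (rule lin2)
  interpret ev: Vector_Spaces.linear free_scale scaleU "lin_extend scaleU (\<lambda>(x, y). \<beta> x y)"
    by (rule U.linear_lin_extend)
  have "lin_extend scaleU (\<lambda>(x, y). \<beta> x y) r = 0" if "r \<in> tensor_relators scaleX scaleY" for r
    using that unfolding tensor_relators_def
    by (auto simp: ev.diff l1.add l1.scale l2.add l2.scale)
  from presented_by_universal[OF T.vector_space_axioms U presented this] show ?thesis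
    by (simp add: split_paired_all)
qed

definition left_span ::
  "('k::field \<Rightarrow> 'x::ab_group_add \<Rightarrow> 'x) \<Rightarrow> ('x \<Rightarrow> 'y \<Rightarrow> 't::ab_group_add) \<Rightarrow> 't \<Rightarrow> 'x set"
  where
  "left_span scaleX tensor t =
     \<Inter> {module.span scaleX (set (map fst xys)) | xys. t = (\<Sum>(x, y)\<leftarrow>xys. tensor x y)}"

definition right_span ::
  "('k::field \<Rightarrow> 'y::ab_group_add \<Rightarrow> 'y) \<Rightarrow> ('x \<Rightarrow> 'y \<Rightarrow> 't::ab_group_add) \<Rightarrow> 't \<Rightarrow> 'y set"
  where
  "right_span scaleY tensor t =
     \<Inter> {module.span scaleY (set (map snd xys)) | xys. t = (\<Sum>(x, y)\<leftarrow>xys. tensor x y)}"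


section \<open>Coproduct slices and geometric products\<close>

text \<open>Indices are counted from \<open>0\<close>: the vectors are \<open>vs ! 0, \<dots>, vs ! (a - 1)\<close>.\<close>

definition shuffle_sign :: "nat \<Rightarrow> nat set \<Rightarrow> int" where
  "shuffle_sign a I = sign (\<lambda>k. if k < a
     then (sorted_list_of_set I @ sorted_list_of_set ({..<a} - I)) ! k else k)"

text \<open>
  \<open>slice_sum scaleT \<iota> i j vs \<beta>\<close> is the sum, over the \<open>(i, j)\<close> coproduct slice of the product of
  \<open>vs\<close>, of the terms \<open>\<beta> A\<^sub>1 A\<^sub>2\<close>, where \<open>\<beta>\<close> is bilinear. The degrees are integers, so the
  sum is empty if one of them is negative.
\<close>

definition slice_sum ::
  "('k::field \<Rightarrow> 't \<Rightarrow> 't) \<Rightarrow> ('v \<Rightarrow> 'e::ring_1) \<Rightarrow> int \<Rightarrow> int \<Rightarrow> 'v list \<Rightarrow>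
   ('e \<Rightarrow> 'e \<Rightarrow> 't) \<Rightarrow> 't::ab_group_add" where
  "slice_sum scaleT \<iota> i j vs \<beta> =
     (\<Sum>I | I \<subseteq> {..<length vs} \<and> int (card I) = i \<and> int (card ({..<length vs} - I)) = j.
        scaleT (of_int (shuffle_sign (length vs) I))
          (\<beta> (ext_prod \<iota> (nths vs I)) (ext_prod \<iota> (nths vs ({..<length vs} - I)))))"

text \<open>
  Extensors span the exterior algebra, so a linear operator is determined by the formulas below.
  Nonzero scalars, as extensors of step \<open>0\<close>, are covered by the empty list and linearity.
\<close>

definition diamond21 ::
  "('k::field \<Rightarrow> 'e \<Rightarrow> 'e) \<Rightarrow> ('k \<Rightarrow> 't \<Rightarrow> 't) \<Rightarrow> ('v \<Rightarrow> 'e::ring_1) \<Rightarrow>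
   ('e \<Rightarrow> 'e \<Rightarrow> 't::ab_group_add) \<Rightarrow> nat \<Rightarrow> 't \<Rightarrow> 't" where
  "diamond21 scaleE scaleT \<iota> tensor h =
     (THE D. Vector_Spaces.linear scaleT scaleT D \<and>
        (\<forall>vs B. extensor scaleE \<iota> (ext_prod \<iota> vs) \<longrightarrow> extensor scaleE \<iota> B \<longrightarrow>
           D (tensor (ext_prod \<iota> vs) B) =
             slice_sum scaleT \<iota> (int (length vs) - int h) (int h) vs
               (\<lambda>A1 A2. tensor A1 (A2 * B))))"

definition diamond12 ::
  "('k::field \<Rightarrow> 'e \<Rightarrow> 'e) \<Rightarrow> ('k \<Rightarrow> 't \<Rightarrow> 't) \<Rightarrow> ('v \<Rightarrow> 'e::ring_1) \<Rightarrow>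
   ('e \<Rightarrow> 'e \<Rightarrow> 't::ab_group_add) \<Rightarrow> nat \<Rightarrow> 't \<Rightarrow> 't" where
  "diamond12 scaleE scaleT \<iota> tensor h =
     (THE D. Vector_Spaces.linear scaleT scaleT D \<and>
        (\<forall>A vs. extensor scaleE \<iota> A \<longrightarrow> extensor scaleE \<iota> (ext_prod \<iota> vs) \<longrightarrow>
           D (tensor A (ext_prod \<iota> vs)) =
             slice_sum scaleT \<iota> (int h) (int (length vs) - int h) vs
               (\<lambda>B1 B2. tensor (A * B1) B2)))"

end

theory Submission
  imports Defs
begin

text \<open>
  Choose lists of vectors \<open>as\<close>, \<open>bs\<close>, \<open>cs\<close> such that \<open>cs\<close> is a basis of the intersection of
  the two subspaces and such that adding \<open>as\<close> or \<open>bs\<close> to it gives a basis of the first or of the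
  second subspace; then the three lists together are a basis of the sum (\<open>adapted_basis\<close>).
  Extensors with the same subspace are proportional, so \<open>A\<close> and \<open>B\<close> are multiples of the products
  \<open>as cs\<close> and \<open>bs cs\<close>. In the coproduct slice of \<open>as cs\<close>, every term that moves a vector of
  \<open>cs\<close> to the right is killed by the factor \<open>B\<close>, which contains that vector already. Up to nonzero
  coefficients, the first geometric product is therefore the sum of

    \<open>(as\<^bsub>S'\<^esub> cs) \<otimes> (as\<^bsub>S\<^esub> bs cs)\<close>

  over the sets \<open>S\<close> of \<open>h\<close> indices, where \<open>S'\<close> is the complement of \<open>S\<close>
  (\<open>diamond21_adapted\<close>); the second one behaves in the same way (\<open>diamond12_adapted\<close>).

  Each of the two families occurring here has dual functionals: multiplication by the product of
  \<open>as\<close> over the complement of one index set annihilates all other members of the family and turns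
  the remaining one into a product of independent vectors, which is nonzero (\<open>dual_functional\<close>).
  If one family of a sum of pure tensors has dual functionals, contracting any representation of the
  tensor with them recovers the members of the other family, so the left and right spans are exactly
  the spans of the two families (\<open>left_span_eq\<close>, \<open>right_span_eq\<close>). Finally, an extensor \<open>H\<close>
  whose subspace lies between the spans of \<open>ds\<close> and of \<open>as ds\<close> is a product of some vectors with
  \<open>ds\<close>; expanding these vectors in the basis writes \<open>H\<close> as a combination of the products
  \<open>as\<^bsub>S\<^esub> ds\<close>, which are themselves such extensors (\<open>span_extensors_between\<close>). This identifies the
  spans of the families with the spans in the claim.

  Two facts about the exterior algebra given by generators and relations support this. A product of
  independent vectors is nonzero, because contracting it with a functional that is \<open>1\<close> on the first
  vector and \<open>0\<close> on the others removes the first vector (\<open>ext_prod_nonzero\<close>). The coproduct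
  slice is a well-defined linear map, because the signed sum over index sets obeys a recursion on the
  first vector of a word (\<open>slice_sum_Cons\<close>), from which the relators are seen to be respected
  (\<open>slice_sum_linear\<close>); hence the operators in the claim exist (\<open>diamond21_well_defined\<close>,
  \<open>diamond12_well_defined\<close>).
\<close>

section \<open>Index sets and subwords\<close>

definition k_subsets :: "nat \<Rightarrow> nat \<Rightarrow> nat set set" where
  "k_subsets n k = {S. S \<subseteq> {..<n} \<and> card S = k}"

lemma finite_k_subsets [simp]: "finite (k_subsets n k)"
  unfolding k_subsets_def by (rule finite_subset[of _ "Pow {..<n}"]) auto

lemma image_compl_k_subsets:
  assumes "h \<le> n"
  shows "(\<lambda>S. {..<n} - S) ` k_subsets n h = k_subsets n (n - h)"
proof -
  have *: "{..<n} - S \<in> k_subsets n (n - k)" if "S \<in> k_subsets n k" for S k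
    using that by (auto simp: k_subsets_def card_Diff_subset finite_subset)
  have "S \<in> (\<lambda>S. {..<n} - S) ` k_subsets n h" if S: "S \<in> k_subsets n (n - h)" for S
  proof (rule image_eqI)
    show "{..<n} - S \<in> k_subsets n h"
      using *[OF S] assms by simp
    show "S = {..<n} - ({..<n} - S)"
      using S by (auto simp: k_subsets_def)
  qed
  with * show ?thesis
    by blast
qed

lemma nths_append_left:
  assumes "S \<subseteq> {..<length xs}"
  shows "nths (xs @ ys) S = nths xs S"
    and "nths (xs @ ys) ({..<length (xs @ ys)} - S) = nths xs ({..<length xs} - S) @ ys"
proof -
  have "{j. j + length xs \<in> S} = {}"
    using assms by auto
  then show "nths (xs @ ys) S = nths xs S"
    by (simp add: nths_append)
  have "nths xs ({..<length (xs @ ys)} - S) = nths xs ({..<length xs} - S)"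
    unfolding nths_def
    by (intro arg_cong[of _ _ "map fst"] filter_cong) (auto simp: set_zip)
  moreover have "nths ys {j. j + length xs \<in> {..<length (xs @ ys)} - S} = ys"
    using assms by (intro nths_all) auto
  ultimately show "nths (xs @ ys) ({..<length (xs @ ys)} - S) = nths xs ({..<length xs} - S) @ ys"
    by (simp add: nths_append)
qed

text \<open>
  This makes terms of a slice vanish: if the vectors of \<open>ys\<close> are also factors of the other
  extensor, a term that multiplies this subword with that extensor repeats a vector.
\<close>

lemma nths_append_meets_right:
  assumes "S \<subseteq> {..<length (xs @ ys)}" "\<not> S \<subseteq> {..<length xs}"
  shows "set (nths (xs @ ys) S) \<inter> set ys \<noteq> {}"
proof -
  obtain i where i: "i \<in> S" "length xs \<le> i" "i < length (xs @ ys)"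
    using assms by fastforce
  then have "(xs @ ys) ! i \<in> set ys"
    by (auto simp: nth_append)
  moreover have "(xs @ ys) ! i \<in> set (nths (xs @ ys) S)"
    using i by (auto simp only: set_nths)
  ultimately show ?thesis
    by blast
qed

section \<open>Signs of shuffles\<close>

text \<open>
  Extending a list by the identity makes it a permutation of all natural numbers, so that its sign
  can be compared with that of a list of another length.
\<close>

definition list_perm :: "nat list \<Rightarrow> nat \<Rightarrow> nat" where
  "list_perm L k = (if k < length L then L ! k else k)"

lemma list_perm_permutes:
  assumes "set L = {..<length L}"
  shows "list_perm L permutes {..<length L}"
proof (rule bij_imp_permutes)
  have "distinct L"
    by (rule card_distinct) (simp add: assms)
  from bij_betw_nth[OF this refl refl] have "bij_betw ((!) L) {..<length L} {..<length L}"
    by (simp add: assms)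
  then show "bij_betw (list_perm L) {..<length L} {..<length L}"
    by (rule bij_betw_cong[THEN iffD1, rotated]) (simp add: list_perm_def)
qed (simp add: list_perm_def)

lemma sign_list_perm_swap:
  assumes "set (xs @ a # b # ys) = {..<length (xs @ a # b # ys)}"
  shows "sign (list_perm (xs @ a # b # ys)) = - sign (list_perm (xs @ b # a # ys))"
proof -
  let ?L = "xs @ b # a # ys" and ?t = "Transposition.transpose (length xs) (Suc (length xs))"
  have eq: "list_perm (xs @ a # b # ys) = list_perm ?L \<circ> ?t"
    by (auto simp: fun_eq_iff list_perm_def nth_append nth_Cons' Transposition.transpose_def)
  have "set ?L = {..<length ?L}"
    using assms by auto
  from list_perm_permutes[OF this] have "permutation (list_perm ?L)"
    by (rule permutes_imp_permutation[rotated]) simp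
  then show ?thesis
    by (simp add: eq sign_compose permutation_swap_id sign_swap_id)
qed

text \<open>
  Moving \<open>z\<close> to the front passes the entries of \<open>xs\<close> one at a time, and each exchange of
  neighbours changes the sign.
\<close>

lemma sign_list_perm_move:
  assumes "set (xs @ z # ys) = {..<length (xs @ z # ys)}"
  shows "sign (list_perm (xs @ z # ys)) = (-1) ^ length xs * sign (list_perm (z # xs @ ys))"
  using assms
proof (induction xs arbitrary: ys rule: rev_induct)
  case (snoc x xs)
  have "sign (list_perm (xs @ x # z # ys)) = - sign (list_perm (xs @ z # x # ys))"
    using snoc.prems by (intro sign_list_perm_swap) simp
  also have "sign (list_perm (xs @ z # x # ys)) =
      (-1) ^ length xs * sign (list_perm (z # xs @ x # ys))"
    using snoc.prems by (intro snoc.IH) auto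
  finally show ?case
    by simp
qed simp

lemma sign_list_perm_shift:
  assumes "set L = {..<length L}"
  shows "sign (list_perm (0 # map Suc L)) = sign (list_perm L)"
proof -
  have "list_perm (0 # map Suc L) = map_permutation {..<length L} Suc (list_perm L)"
  proof
    fix k
    show "list_perm (0 # map Suc L) k = map_permutation {..<length L} Suc (list_perm L) k"
      by (cases k) (auto simp: list_perm_def map_permutation_def restrict_id_def)
  qed
  then show ?thesis
    using list_perm_permutes[OF assms] by (simp add: sign_map_permutation)
qed

lemma shuffle_sign_list_perm:
  assumes "I \<subseteq> {..<n}"
  shows "shuffle_sign n I =
    sign (list_perm (sorted_list_of_set I @ sorted_list_of_set ({..<n} - I)))"
proof -
  have "finite I"
    using assms finite_subset by blast
  then have "length (sorted_list_of_set I @ sorted_list_of_set ({..<n} - I)) = n"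
    using assms card_mono[OF _ assms] by (simp add: card_Diff_subset)
  then show ?thesis
    by (simp add: shuffle_sign_def list_perm_def[abs_def])
qed

lemma sorted_list_of_Suc_image:
  assumes "finite I"
  shows "sorted_list_of_set (Suc ` I) = map Suc (sorted_list_of_set I)"
  using assms
  by (intro sorted_distinct_set_unique) (auto simp: distinct_map sorted_wrt_map)

lemma insort_0_nat: "insort 0 (xs :: nat list) = 0 # xs"
  by (cases xs) auto

text \<open>
  The index sets of a word of length \<open>n + 1\<close> are, after a shift by one, the index sets \<open>I\<close> of its
  tail with or without the index \<open>0\<close>. If \<open>0\<close> belongs to the left part, it stays in front; otherwise
  it stands behind the left part and must be moved past all of \<open>I\<close>.
\<close>

lemma shuffle_sign_Suc:
  assumes "I \<subseteq> {..<n}"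
  shows "shuffle_sign (Suc n) (insert 0 (Suc ` I)) = shuffle_sign n I"
    and "shuffle_sign (Suc n) (Suc ` I) = (-1) ^ card I * shuffle_sign n I"
proof -
  let ?L = "sorted_list_of_set I" and ?R = "sorted_list_of_set ({..<n} - I)"
  have fin: "finite I"
    using assms finite_subset by blast
  have len: "length ?L + length ?R = n"
    using assms fin card_mono[OF _ assms] by (simp add: card_Diff_subset)
  have set: "set (?L @ ?R) = {..<length (?L @ ?R)}"
    using assms fin len by auto
  have sub: "insert 0 (Suc ` I) \<subseteq> {..<Suc n}" "Suc ` I \<subseteq> {..<Suc n}"
    using assms by auto
  have compl: "{..<Suc n} - insert 0 (Suc ` I) = Suc ` ({..<n} - I)"
    "{..<Suc n} - Suc ` I = insert 0 (Suc ` ({..<n} - I))"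
    by (auto simp: lessThan_Suc_eq_insert_0)
  show "shuffle_sign (Suc n) (insert 0 (Suc ` I)) = shuffle_sign n I"
    using sign_list_perm_shift[OF set] assms fin sub
    by (simp add: shuffle_sign_list_perm compl sorted_list_of_Suc_image insort_0_nat del: image_Suc_lessThan)
  have "sign (list_perm (map Suc ?L @ 0 # map Suc ?R)) =
      (-1) ^ length (map Suc ?L) * sign (list_perm (0 # map Suc ?L @ map Suc ?R))"
  proof (rule sign_list_perm_move)
    have "set (map Suc ?L @ 0 # map Suc ?R) = insert 0 (Suc ` set (?L @ ?R))"
      by auto
    also have "\<dots> = {..<length (map Suc ?L @ 0 # map Suc ?R)}"
      unfolding set by (simp add: lessThan_Suc_eq_insert_0)
    finally show "set (map Suc ?L @ 0 # map Suc ?R) = \<dots>" .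
  qed
  then show "shuffle_sign (Suc n) (Suc ` I) = (-1) ^ card I * shuffle_sign n I"
    using sign_list_perm_shift[OF set] assms fin sub
    by (simp add: shuffle_sign_list_perm compl sorted_list_of_Suc_image insort_0_nat)
qed

section \<open>Expanding a coproduct slice along the first vector\<close>

lemma subsets_lessThan_Suc:
  "Pow {..<Suc n} = (\<lambda>I. insert 0 (Suc ` I)) ` Pow {..<n} \<union> (`) Suc ` Pow {..<n}"
proof -
  have "Pow {..<Suc n} = Pow (insert 0 (Suc ` {..<n}))"
    by (simp only: lessThan_Suc_eq_insert_0)
  also have "\<dots> = Pow (Suc ` {..<n}) \<union> insert 0 ` Pow (Suc ` {..<n})"
    by (rule Pow_insert)
  also have "\<dots> = (\<lambda>I. insert 0 (Suc ` I)) ` Pow {..<n} \<union> (`) Suc ` Pow {..<n}"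
    by (auto simp: image_Pow_surj[symmetric] image_image)
  finally show ?thesis .
qed

context vector_space
begin

text \<open>
  This is the multiplicativity of the coproduct for the factor
  \<open>v \<otimes> 1 + 1 \<otimes> v\<close> of the first vector: \<open>v\<close> goes to the left, or it goes to the right past
  the \<open>i\<close> vectors of the left part. The integer power makes the sign change with \<open>i\<close> also for
  negative \<open>i\<close>, where the slice is empty.
\<close>

lemma slice_sum_Cons:
  fixes i j :: int
  shows "slice_sum scale \<iota> i j (v # vs) \<beta> =
     slice_sum scale \<iota> (i - 1) j vs (\<lambda>a b. \<beta> (\<iota> v * a) b) +
     scale ((-1) powi i) (slice_sum scale \<iota> i (j - 1) vs (\<lambda>a b. \<beta> a (\<iota> v * b)))"
proof -
  define n where "n = length vs"
  define P where "P i j I \<longleftrightarrow> int (card I) = i \<and> int (card ({..<n} - I)) = j" for i j I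
  define g where "g I = scale (of_int (shuffle_sign (Suc n) I))
    (\<beta> (ext_prod \<iota> (nths (v # vs) I)) (ext_prod \<iota> (nths (v # vs) ({..<Suc n} - I))))" for I
  define h where "h \<beta>' I = scale (of_int (shuffle_sign n I))
    (\<beta>' (ext_prod \<iota> (nths vs I)) (ext_prod \<iota> (nths vs ({..<n} - I))))" for \<beta>' I
  define Q where "Q I \<longleftrightarrow> int (card I) = i \<and> int (card ({..<Suc n} - I)) = j" for I
  have sub: "finite I" if "I \<in> Pow {..<n}" for I
    using that finite_subset by blast
  have compl: "{..<Suc n} - insert 0 (Suc ` I) = Suc ` ({..<n} - I)"
    "{..<Suc n} - Suc ` I = insert 0 (Suc ` ({..<n} - I))" for I
    by (auto simp: lessThan_Suc_eq_insert_0)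
  have Q1: "Q (insert 0 (Suc ` I)) = P (i - 1) j I" if "I \<in> Pow {..<n}" for I
    using sub[OF that] by (auto simp: Q_def P_def compl card_insert_if card_image)
  have Q2: "Q (Suc ` I) = P i (j - 1) I" if "I \<in> Pow {..<n}" for I
    using sub[OF that] by (auto simp: Q_def P_def compl card_insert_if card_image)
  have g1: "g (insert 0 (Suc ` I)) = h (\<lambda>a b. \<beta> (\<iota> v * a) b) I" if "I \<in> Pow {..<n}" for I
    using that by (auto simp: g_def h_def shuffle_sign_Suc compl nths_Cons inj_image_mem_iff set_diff_eq)
  have g2: "g (Suc ` I) = scale ((-1) powi i) (h (\<lambda>a b. \<beta> a (\<iota> v * b)) I)"
    if "I \<in> Pow {..<n}" "P i (j - 1) I" for I
    using that by (auto simp: g_def h_def P_def shuffle_sign_Suc compl nths_Cons inj_image_mem_iff set_diff_eq)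
  have "slice_sum scale \<iota> i j (v # vs) \<beta> = (\<Sum>I\<in>Pow {..<Suc n}. if Q I then g I else 0)"
    unfolding slice_sum_def g_def Q_def n_def[symmetric] length_Cons
    by (subst sum.inter_filter[symmetric]) (auto intro!: sum.cong)
  also have "\<dots> = (\<Sum>I\<in>(\<lambda>I. insert 0 (Suc ` I)) ` Pow {..<n}. if Q I then g I else 0) +
      (\<Sum>I\<in>(`) Suc ` Pow {..<n}. if Q I then g I else 0)"
    unfolding subsets_lessThan_Suc by (rule sum.union_disjoint) auto
  also have "(\<Sum>I\<in>(\<lambda>I. insert 0 (Suc ` I)) ` Pow {..<n}. if Q I then g I else 0) =
      (\<Sum>I\<in>Pow {..<n}. if P (i - 1) j I then h (\<lambda>a b. \<beta> (\<iota> v * a) b) I else 0)"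
    by (subst sum.reindex) (auto simp: Q1 g1 inj_on_def intro!: sum.cong)
  also have "\<dots> = slice_sum scale \<iota> (i - 1) j vs (\<lambda>a b. \<beta> (\<iota> v * a) b)"
    unfolding slice_sum_def h_def P_def n_def[symmetric]
    by (subst sum.inter_filter[symmetric]) (auto intro!: sum.cong)
  also have "(\<Sum>I\<in>(`) Suc ` Pow {..<n}. if Q I then g I else 0) =
      (\<Sum>I\<in>Pow {..<n}. scale ((-1) powi i) (if P i (j - 1) I then h (\<lambda>a b. \<beta> a (\<iota> v * b)) I else 0))"
    by (subst sum.reindex) (auto simp: Q2 g2 inj_on_def inj_image_eq_iff intro!: sum.cong)
  also have "\<dots> = scale ((-1) powi i) (slice_sum scale \<iota> i (j - 1) vs (\<lambda>a b. \<beta> a (\<iota> v * b)))"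
    unfolding slice_sum_def h_def P_def n_def[symmetric]
    by (subst scale_sum_right[symmetric], subst sum.inter_filter[symmetric]) (auto intro!: sum.cong)
  finally show ?thesis .
qed

end

section \<open>Functionals and bases adapted to two subspaces\<close>

lemma vector_space_field: "vector_space ((*) :: 'k::field \<Rightarrow> 'k \<Rightarrow> 'k)"
  by unfold_locales (auto simp: algebra_simps)

lemma (in vector_space) exists_functional:
  assumes "independent S"
  shows "\<exists>f. Vector_Spaces.linear scale (*) f \<and> (\<forall>x\<in>S. f x = g x)"
proof -
  interpret vector_space_pair scale "(*) :: 'a \<Rightarrow> 'a \<Rightarrow> 'a"
    by (intro vector_space_pair.intro vector_space_axioms vector_space_field)
  show ?thesis
    by (rule linear_independent_extend[OF assms])
qed

lemma (in vector_space) basis_list_extend: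
  assumes ind: "distinct ds" "independent (set ds)" and sub: "set ds \<subseteq> span F" and "finite F"
  obtains ws where "distinct (ws @ ds)" "independent (set (ws @ ds))"
    "span (set (ws @ ds)) = span F"
proof -
  obtain C where C: "set ds \<subseteq> C" "C \<subseteq> span F" "independent C" "span F \<subseteq> span C"
    using maximal_independent_subset_extend[OF sub ind(2)] by blast
  have "finite C"
    using independent_span_bound[OF \<open>finite F\<close> C(3,2)] by simp
  then obtain ws where ws: "distinct ws" "set ws = C - set ds"
    using finite_distinct_list[of "C - set ds"] by blast
  have "set (ws @ ds) = C"
    using ws C by auto
  moreover have "span C = span F"
    using C span_minimal[OF C(2)] by auto
  ultimately show ?thesis
    using that[of ws] ws ind C by auto
qed

text \<open>
  Extending a basis \<open>cs\<close> of the intersection to bases of \<open>U\<close> and of \<open>W\<close> gives a list that spans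
  the sum. By the dimension formula its length is the dimension of the sum, so it is independent.
\<close>

lemma (in finite_dimensional_vector_space) adapted_basis:
  assumes U: "subspace U" and W: "subspace W"
  obtains as bs cs where "distinct (as @ bs @ cs)" "independent (set (as @ bs @ cs))"
    "span (set cs) = U \<inter> W" "span (set (as @ cs)) = U" "span (set (bs @ cs)) = W"
    "span (set (as @ bs @ cs)) = {x + y | x y. x \<in> U \<and> y \<in> W}"
proof -
  obtain F where F: "finite F" "span F = U"
    using basis_subspace_exists[OF U] by metis
  obtain G where G: "finite G" "span G = W"
    using basis_subspace_exists[OF W] by metis
  obtain C where C: "finite C" "span C = U \<inter> W"
    using basis_subspace_exists[OF subspace_inter[OF U W]] by metis
  obtain cs where cs: "distinct cs" "independent (set cs)" "span (set cs) = U \<inter> W"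
    using basis_list_extend[of "[]" C] C by (auto simp: independent_empty)
  have "set cs \<subseteq> span F" "set cs \<subseteq> span G"
    using cs(3) span_superset[of "set cs"] F G by auto
  then obtain as bs where as: "distinct (as @ cs)" "independent (set (as @ cs))"
      "span (set (as @ cs)) = U"
    and bs: "distinct (bs @ cs)" "independent (set (bs @ cs))" "span (set (bs @ cs)) = W"
    using basis_list_extend[OF cs(1,2)] F G by metis
  let ?L = "as @ bs @ cs" and ?UW = "{x + y | x y. x \<in> U \<and> y \<in> W}"
  have "set ?L = set (as @ cs) \<union> set (bs @ cs)"
    by auto
  then have span: "span (set ?L) = ?UW"
    using as(3) bs(3) by (simp only: span_Un)
  have "dim ?UW + length cs = (length as + length cs) + (length bs + length cs)"
    using dim_sums_Int[OF U W] cs as bs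
      dim_span_eq_card_independent[OF cs(2)] dim_span_eq_card_independent[OF as(2)]
      dim_span_eq_card_independent[OF bs(2)] distinct_card[OF cs(1)]
      distinct_card[OF as(1)] distinct_card[OF bs(1)]
    by simp
  then have dim: "dim ?UW = length ?L"
    by simp
  have "?UW \<subseteq> span (set ?L)" "set ?L \<subseteq> ?UW"
    using span span_superset[of "set ?L"] by auto
  then have ind: "independent (set ?L)"
    using dim card_length[of ?L] by (intro card_le_dim_spanning[of _ ?UW]) auto
  then have "card (set ?L) = length ?L"
    using dim dim_span_eq_card_independent[OF ind] unfolding span by simp
  then have "distinct ?L"
    by (rule card_distinct)
  then show ?thesis
    using that ind cs(3) as(3) bs(3) span by blast
qed

section \<open>Linear maps on the exterior algebra\<close>

context exterior_algebra
begin

interpretation \<iota>: Vector_Spaces.linear scaleV scaleE \<iota>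
  by (rule linear_\<iota>)

lemma span_words: "E.span (range (ext_prod \<iota>)) = UNIV"
proof -
  have "w \<in> E.span (range (ext_prod \<iota>))" for w
  proof -
    obtain p where "lin_extend scaleE (ext_prod \<iota>) p = w"
      using presented unfolding presented_by_def by blast
    then show ?thesis
      unfolding lin_extend_def by (auto intro!: E.span_sum E.span_scale intro: E.span_base)
  qed
  then show ?thesis
    by blast
qed

lemma linear_eq_on_words:
  assumes F: "Vector_Spaces.linear scaleE scaleU F" and G: "Vector_Spaces.linear scaleE scaleU G"
    and eq: "\<And>vs. F (ext_prod \<iota> vs) = G (ext_prod \<iota> vs)"
  shows "F = G"
proof
  fix x
  interpret F: Vector_Spaces.linear scaleE scaleU F by (rule F)
  interpret P: vector_space_pair scaleE scaleU ..
  show "F x = G x"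
    by (rule P.linear_eq_on[OF F G, of x "range (ext_prod \<iota>)"]) (use span_words eq in auto)
qed

text \<open>
  The universal property for linear maps: a function of words that is multilinear and vanishes on
  words with two equal neighbours factors through the exterior algebra.
\<close>

lemma linear_from_words:
  assumes U: "vector_space scaleU"
    and add: "\<And>xs ys u v. g (xs @ (u + v) # ys) = g (xs @ u # ys) + g (xs @ v # ys)"
    and scale: "\<And>xs ys c v. g (xs @ scaleV c v # ys) = scaleU c (g (xs @ v # ys))"
    and square: "\<And>xs ys v. g (xs @ v # v # ys) = 0"
  shows "\<exists>F. Vector_Spaces.linear scaleE scaleU F \<and> (\<forall>vs. F (ext_prod \<iota> vs) = g vs)"
proof -
  interpret U: vector_space scaleU by (rule U)
  interpret ev: Vector_Spaces.linear free_scale scaleU "lin_extend scaleU g"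
    by (rule U.linear_lin_extend)
  have "lin_extend scaleU g r = 0" if "r \<in> exterior_relators scaleV" for r
    using that unfolding exterior_relators_def
    by (auto simp: ev.diff add scale square)
  from presented_by_universal[OF E.vector_space_axioms U presented this] show ?thesis
    by blast
qed

section \<open>Products of vectors\<close>

lemma \<iota>_anticommute: "\<iota> u * \<iota> v = - (\<iota> v * \<iota> u)"
proof -
  have "\<iota> (u + v) * \<iota> (u + v) = 0"
    by (rule \<iota>_square)
  then have "\<iota> u * \<iota> v + \<iota> v * \<iota> u = 0"
    by (simp add: \<iota>.add distrib_left distrib_right \<iota>_square add.commute)
  then show ?thesis
    by (rule eq_neg_iff_add_eq_0[THEN iffD2])
qed

lemma \<iota>_anticommute_left: "\<iota> u * (\<iota> v * x) = - (\<iota> v * (\<iota> u * x))"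
  by (metis \<iota>_anticommute minus_mult_left mult.assoc)

lemma \<iota>_square_left: "\<iota> v * (\<iota> v * x) = 0"
  by (metis \<iota>_square mult.assoc mult_zero_left)

lemma ext_prod_middle:
  "\<exists>s\<in>{1, -1}. ext_prod \<iota> (xs @ v # ys) = scaleE s (ext_prod \<iota> (v # xs @ ys))"
proof (induction xs)
  case (Cons x xs)
  then obtain s where s: "s \<in> {1, -1}"
    and "ext_prod \<iota> (xs @ v # ys) = scaleE s (ext_prod \<iota> (v # xs @ ys))" by blast
  then have "ext_prod \<iota> ((x # xs) @ v # ys) = scaleE (- s) (ext_prod \<iota> (v # (x # xs) @ ys))"
    by (simp add: scale_mult_right \<iota>_anticommute_left[of x v])
  then show ?case
    using s by (intro bexI[of _ "- s"]) auto
qed (auto intro!: bexI[of _ 1])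

lemma ext_prod_permute:
  assumes "mset xs = mset ys"
  shows "\<exists>s\<in>{1, -1}. ext_prod \<iota> xs = scaleE s (ext_prod \<iota> ys)"
  using assms
proof (induction xs arbitrary: ys)
  case (Cons x xs)
  then have "x \<in> set ys"
    by (metis list.set_intros(1) set_mset_mset)
  then obtain ys1 ys2 where ys: "ys = ys1 @ x # ys2"
    by (meson split_list)
  have "mset xs = mset (ys1 @ ys2)"
    using Cons.prems ys by simp
  from Cons.IH[OF this] obtain s where s: "s \<in> {1, -1}"
    "ext_prod \<iota> xs = scaleE s (ext_prod \<iota> (ys1 @ ys2))"
    by blast
  obtain r where r: "r \<in> {1, -1}"
    "ext_prod \<iota> ys = scaleE r (ext_prod \<iota> (x # ys1 @ ys2))"
    using ext_prod_middle[of ys1 x ys2] ys by blast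
  have "ext_prod \<iota> (x # xs) = scaleE (s * r) (ext_prod \<iota> ys)"
    using s r by (auto simp: scale_mult_right)
  then show ?case
    using s r by (intro bexI[of _ "s * r"]) auto
qed (auto intro!: bexI[of _ 1])

lemma ext_prod_permute_distinct:
  assumes "distinct xs" "distinct ys" "set xs = set ys"
  shows "\<exists>s\<in>{1, -1}. ext_prod \<iota> xs = scaleE s (ext_prod \<iota> ys)"
  using assms by (intro ext_prod_permute) (simp add: set_eq_iff_mset_eq_distinct)

lemma subspace_annihilator: "V.subspace {v. \<iota> v * x = 0}"
  by (rule V.subspaceI) (simp_all add: \<iota>.add \<iota>.scale distrib_right scale_mult_left)

text \<open>
  A vector of the word can be moved next to an equal vector, and the annihilator of a product is a
  subspace.
\<close>

lemma \<iota>_mult_ext_prod_span: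
  assumes "v \<in> V.span (set vs)"
  shows "\<iota> v * ext_prod \<iota> vs = 0"
proof -
  have "\<iota> u * ext_prod \<iota> vs = 0" if "u \<in> set vs" for u
    using that by (induction vs) (auto simp: \<iota>_square_left \<iota>_anticommute_left[of u])
  then have "V.span (set vs) \<subseteq> {v. \<iota> v * ext_prod \<iota> vs = 0}"
    by (intro V.span_minimal subspace_annihilator) auto
  then show ?thesis
    using assms by blast
qed

text \<open>
  The contraction with a functional \<open>f\<close> is the antiderivation of the exterior algebra with
  \<open>v \<mapsto> f v\<close>.
\<close>

primrec contraction :: "('v \<Rightarrow> 'k) \<Rightarrow> 'v list \<Rightarrow> 'e" where
  "contraction f [] = 0"
| "contraction f (v # vs) = scaleE (f v) (ext_prod \<iota> vs) - \<iota> v * contraction f vs"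

lemma contraction_linear:
  assumes f: "Vector_Spaces.linear scaleV (*) f"
  shows "\<exists>D. Vector_Spaces.linear scaleE scaleE D \<and>
    (\<forall>vs. D (ext_prod \<iota> vs) = contraction f vs)"
proof (rule linear_from_words)
  interpret f: Vector_Spaces.linear scaleV "(*)" f by (rule f)
  show "vector_space scaleE" ..
  show "contraction f (xs @ (u + v) # ys) = contraction f (xs @ u # ys) + contraction f (xs @ v # ys)"
    for xs ys u v
    by (induction xs)
      (simp_all add: f.add \<iota>.add distrib_left distrib_right E.scale_left_distrib
        E.scale_right_distrib)
  show "contraction f (xs @ scaleV c v # ys) = scaleE c (contraction f (xs @ v # ys))" for xs ys c v
    by (induction xs)
      (simp_all add: f.scale \<iota>.scale E.scale_right_diff_distrib scale_mult_left scale_mult_right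
        mult.commute)
  show "contraction f (xs @ v # v # ys) = 0" for xs ys v
    by (induction xs)
      (simp_all add: right_diff_distrib scale_mult_right \<iota>_square_left)
qed

lemma contraction_eq_0:
  assumes "\<And>v. v \<in> set vs \<Longrightarrow> f v = 0"
  shows "contraction f vs = 0"
  using assms by (induction vs) simp_all

text \<open>
  Contracting with a functional that is \<open>1\<close> on the first vector and \<open>0\<close> on the others maps the
  product to the product of the others, which is nonzero by induction. The induction starts at
  \<open>1 \<noteq> 0\<close>.
\<close>

lemma ext_prod_nonzero:
  assumes "distinct vs" "V.independent (set vs)"
  shows "ext_prod \<iota> vs \<noteq> 0"
  using assms
proof (induction vs)
  case (Cons v vs)
  then have nz: "ext_prod \<iota> vs \<noteq> 0"
    by (auto dest: V.independent_mono)
  obtain f where f: "Vector_Spaces.linear scaleV (*) f"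
    and fv: "\<And>u. u \<in> set (v # vs) \<Longrightarrow> f u = (if u = v then 1 else 0)"
    using V.exists_functional[OF Cons.prems(2), of "\<lambda>u. if u = v then 1 else 0"] by blast
  obtain D where D: "Vector_Spaces.linear scaleE scaleE D"
    and Dv: "\<And>vs. D (ext_prod \<iota> vs) = contraction f vs"
    using contraction_linear[OF f] by blast
  interpret D: Vector_Spaces.linear scaleE scaleE D by (rule D)
  have "contraction f vs = 0"
    using fv Cons.prems by (intro contraction_eq_0) auto
  then have "D (ext_prod \<iota> (v # vs)) = ext_prod \<iota> vs"
    unfolding Dv using fv[of v] by simp
  with nz show ?case
    by (metis D.zero)
qed simp

lemma ext_prod_nonzero_iff:
  "ext_prod \<iota> vs \<noteq> 0 \<longleftrightarrow> distinct vs \<and> V.independent (set vs)"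
proof
  show "ext_prod \<iota> vs \<noteq> 0 \<Longrightarrow> distinct vs \<and> V.independent (set vs)"
  proof (induction vs)
    case (Cons v vs)
    then have "v \<notin> V.span (set vs)"
      using \<iota>_mult_ext_prod_span by auto
    moreover have "ext_prod \<iota> vs \<noteq> 0"
      using Cons.prems by auto
    ultimately show ?case
      using Cons.IH by (auto simp: V.independent_insert intro: V.span_base)
  qed (simp add: V.independent_empty)
qed (use ext_prod_nonzero in blast)

text \<open>
  The span of the factors depends only on the extensor, since it consists of the vectors \<open>v\<close> that
  annihilate it: if \<open>v\<close> is outside the span, the product with \<open>v\<close> has independent factors.
\<close>

lemma extensor_space_ext_prod:
  assumes "scaleE c (ext_prod \<iota> vs) \<noteq> 0"
  shows "extensor_space scaleV scaleE \<iota> (scaleE c (ext_prod \<iota> vs)) = V.span (set vs)"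
proof -
  have ann: "{v. \<iota> v * scaleE d (ext_prod \<iota> us) = 0} = V.span (set us)"
    if "scaleE d (ext_prod \<iota> us) \<noteq> 0" for d us
  proof -
    have us: "distinct us" "V.independent (set us)" and "d \<noteq> 0"
      using that ext_prod_nonzero_iff[of us] by auto
    have "v \<in> V.span (set us)" if "\<iota> v * ext_prod \<iota> us = 0" for v
    proof (rule ccontr)
      assume "v \<notin> V.span (set us)"
      then have "distinct (v # us) \<and> V.independent (set (v # us))"
        using us by (auto simp: V.independent_insert intro: V.span_base)
      with that show False
        using ext_prod_nonzero_iff[of "v # us"] by simp
    qed
    then show ?thesis
      using \<open>d \<noteq> 0\<close> by (auto simp: scale_mult_right \<iota>_mult_ext_prod_span)
  qed
  show ?thesis
    unfolding extensor_space_def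
  proof (rule the_equality)
    fix U assume "\<exists>d us. scaleE c (ext_prod \<iota> vs) = scaleE d (ext_prod \<iota> us) \<and> U = V.span (set us)"
    then show "U = V.span (set vs)"
      using ann assms by metis
  qed blast
qed

lemma extensor_ext_prod:
  assumes "ext_prod \<iota> vs \<noteq> 0"
  shows "extensor scaleE \<iota> (ext_prod \<iota> vs)"
proof -
  have "ext_prod \<iota> vs = scaleE 1 (ext_prod \<iota> vs)"
    by simp
  with assms show ?thesis
    unfolding extensor_def extensor_of_step_def by blast
qed

lemma extensorE:
  assumes "extensor scaleE \<iota> H"
  obtains c vs where "H = scaleE c (ext_prod \<iota> vs)" "c \<noteq> 0" "distinct vs"
    "V.independent (set vs)" "extensor_space scaleV scaleE \<iota> H = V.span (set vs)"
    "V.dim (extensor_space scaleV scaleE \<iota> H) = length vs"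
proof -
  obtain c vs where H: "H = scaleE c (ext_prod \<iota> vs)" "H \<noteq> 0"
    using assms unfolding extensor_def extensor_of_step_def by blast
  then have vs: "distinct vs" "V.independent (set vs)" and "c \<noteq> 0"
    using ext_prod_nonzero_iff[of vs] by auto
  moreover have "extensor_space scaleV scaleE \<iota> H = V.span (set vs)"
    using H extensor_space_ext_prod by blast
  ultimately show ?thesis
    using that[OF H(1)] by (simp add: V.dim_eq_card_independent distinct_card)
qed

section \<open>Extensors between two subspaces\<close>

text \<open>
  Multilinear expansion of the vectors \<open>ws\<close> in terms of \<open>as\<close> and \<open>ds\<close>. Terms with a vector of
  \<open>ds\<close> or with a repeated vector of \<open>as\<close> vanish, and the others can be sorted.
\<close>

lemma ext_prod_mult_expand:
  assumes "distinct as" and "set ws \<subseteq> V.span (set (as @ ds))"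
  shows "ext_prod \<iota> (ws @ ds) \<in>
    E.span ((\<lambda>S. ext_prod \<iota> (nths as S @ ds)) ` k_subsets (length as) (length ws))"
  using assms(2)
proof (induction ws)
  case Nil
  have "k_subsets (length as) 0 = {{}}"
    by (auto simp: k_subsets_def dest: finite_subset)
  then show ?case
    by (auto intro: E.span_base)
next
  case (Cons w ws)
  let ?y = "\<lambda>S. ext_prod \<iota> (nths as S @ ds)"
  let ?N = "E.span (?y ` k_subsets (length as) (length (w # ws)))"
  have step: "\<iota> u * ?y S \<in> ?N"
    if u: "u \<in> set (as @ ds)" and S: "S \<in> k_subsets (length as) (length ws)" for u S
  proof (cases "u \<in> set (nths as S @ ds)")
    case True
    then show ?thesis
      by (simp add: \<iota>_mult_ext_prod_span V.span_base E.span_zero del: ext_prod_simps)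
  next
    case False
    with u obtain i where i: "i < length as" "u = as ! i"
      by (auto simp: in_set_conv_nth)
    have "i \<notin> S"
      using False i by (auto simp: set_nths)
    have "finite S"
      using S finite_subset unfolding k_subsets_def by blast
    then have S': "insert i S \<in> k_subsets (length as) (length (w # ws))"
      using S i \<open>i \<notin> S\<close> by (auto simp: k_subsets_def)
    have "set (u # nths as S) = set (nths as (insert i S))"
      using i by (auto simp: set_nths)
    moreover have "distinct (u # nths as S)" "distinct (nths as (insert i S))"
      using False assms(1) by auto
    ultimately obtain s
      where "ext_prod \<iota> (u # nths as S) = scaleE s (ext_prod \<iota> (nths as (insert i S)))"
      using ext_prod_permute_distinct by blast
    then have "\<iota> u * ?y S = scaleE s (?y (insert i S))"
      by (simp add: mult.assoc[symmetric] scale_mult_left)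
    also have "\<dots> \<in> ?N"
      by (intro E.span_scale E.span_base imageI S')
    finally show ?thesis .
  qed
  have "\<iota> u * x \<in> ?N"
    if u: "u \<in> set (as @ ds)" and x: "x \<in> E.span (?y ` k_subsets (length as) (length ws))" for u x
  proof -
    have "E.subspace {x. \<iota> u * x \<in> ?N}"
      by (rule E.subspaceI)
        (auto simp: distrib_left scale_mult_right E.span_zero intro: E.span_add E.span_scale)
    then have "E.span (?y ` k_subsets (length as) (length ws)) \<subseteq> {x. \<iota> u * x \<in> ?N}"
      using step[OF u] by (intro E.span_minimal) auto
    with x show ?thesis
      by blast
  qed
  then have "\<iota> u * ext_prod \<iota> (ws @ ds) \<in> ?N" if "u \<in> set (as @ ds)" for u
    using Cons that by simp
  moreover have "V.subspace {u. \<iota> u * ext_prod \<iota> (ws @ ds) \<in> ?N}"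
    by (rule V.subspaceI)
      (auto simp: \<iota>.add \<iota>.scale distrib_right scale_mult_left E.span_zero
        simp del: ext_prod_simps intro: E.span_add E.span_scale)
  ultimately have "V.span (set (as @ ds)) \<subseteq> {u. \<iota> u * ext_prod \<iota> (ws @ ds) \<in> ?N}"
    by (intro V.span_minimal) auto
  then show ?case
    using Cons.prems by auto
qed

text \<open>
  Expanding \<open>ws\<close> in the basis \<open>vs\<close> leaves a single term, as the only index set of full size is the
  set of all indices.
\<close>

lemma ext_prod_proportional:
  assumes "distinct vs" "V.independent (set vs)" "distinct ws" "V.independent (set ws)"
    and "V.span (set vs) = V.span (set ws)"
  obtains c where "c \<noteq> 0" "ext_prod \<iota> ws = scaleE c (ext_prod \<iota> vs)"
proof -
  have len: "length ws = length vs"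
    using assms by (metis V.dim_span_eq_card_independent distinct_card)
  have "S = {..<length vs}" if "S \<in> k_subsets (length vs) (length vs)" for S
    using that card_subset_eq[of "{..<length vs}" S] by (auto simp: k_subsets_def)
  then have sub: "k_subsets (length vs) (length vs) \<subseteq> {{..<length vs}}"
    by blast
  have "ext_prod \<iota> (ws @ []) \<in>
      E.span ((\<lambda>S. ext_prod \<iota> (nths vs S @ [])) ` k_subsets (length vs) (length ws))"
    using assms V.span_superset[of "set ws"] by (intro ext_prod_mult_expand) auto
  also have "\<dots> \<subseteq> E.span {ext_prod \<iota> vs}"
    using sub by (intro E.span_mono) (auto simp: len)
  finally obtain c where "ext_prod \<iota> ws = scaleE c (ext_prod \<iota> vs)"
    by (auto simp: E.span_singleton)
  moreover have "c \<noteq> 0"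
    using calculation ext_prod_nonzero_iff[of ws] assms by auto
  ultimately show ?thesis
    using that by blast
qed

text \<open>
  An extensor \<open>H\<close> in this interval is a multiple of \<open>ws ds\<close> for any \<open>ws\<close> that extends \<open>ds\<close> to
  a basis of its subspace, and \<open>ws\<close> can be expanded. Conversely, the products on the right have
  independent factors and belong to the interval.
\<close>

lemma span_extensors_between:
  assumes dist: "distinct (as @ ds)" and ind: "V.independent (set (as @ ds))"
  shows "E.span {H. extensor scaleE \<iota> H \<and> V.span (set ds) \<subseteq> extensor_space scaleV scaleE \<iota> H \<and>
      extensor_space scaleV scaleE \<iota> H \<subseteq> V.span (set (as @ ds)) \<and>
      V.dim (extensor_space scaleV scaleE \<iota> H) = length ds + m} =
    E.span ((\<lambda>S. ext_prod \<iota> (nths as S @ ds)) ` k_subsets (length as) m)"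
    (is "E.span ?X = E.span ?Y")
proof -
  have "H \<in> E.span ?Y" if "H \<in> ?X" for H
  proof -
    obtain c vs where H: "H = scaleE c (ext_prod \<iota> vs)" "c \<noteq> 0" "distinct vs"
      "V.independent (set vs)" "extensor_space scaleV scaleE \<iota> H = V.span (set vs)"
      "V.dim (extensor_space scaleV scaleE \<iota> H) = length vs"
      using \<open>H \<in> ?X\<close> extensorE by blast
    have "set ds \<subseteq> V.span (set vs)"
      using \<open>H \<in> ?X\<close> V.span_superset[of "set ds"] H(5) by auto
    moreover have "V.independent (set ds)" "distinct ds"
      using dist ind V.independent_mono[OF ind, of "set ds"] by auto
    ultimately obtain ws where ws: "distinct (ws @ ds)" "V.independent (set (ws @ ds))"
      "V.span (set (ws @ ds)) = V.span (set vs)"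
      using V.basis_list_extend[of ds "set vs"] by blast
    have "length (ws @ ds) = length vs"
      using ws H by (metis V.dim_span_eq_card_independent distinct_card)
    then have "length ws = m"
      using \<open>H \<in> ?X\<close> H(6) by auto
    moreover have "set ws \<subseteq> V.span (set (as @ ds))"
      using \<open>H \<in> ?X\<close> ws(3) H(5) V.span_superset[of "set (ws @ ds)"] by auto
    ultimately have "ext_prod \<iota> (ws @ ds) \<in> E.span ?Y"
      using ext_prod_mult_expand[of as ws ds] dist by auto
    moreover obtain d where "ext_prod \<iota> vs = scaleE d (ext_prod \<iota> (ws @ ds))"
      using ext_prod_proportional[OF ws(1,2) H(3,4) ws(3)] by blast
    ultimately show ?thesis
      using H(1) by (simp add: E.span_scale del: ext_prod_simps)
  qed
  then have 1: "?X \<subseteq> E.span ?Y"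
    by blast
  have "ext_prod \<iota> (nths as S @ ds) \<in> ?X" if S: "S \<in> k_subsets (length as) m" for S
  proof -
    let ?H = "ext_prod \<iota> (nths as S @ ds)"
    have sub: "set (nths as S @ ds) \<subseteq> set (as @ ds)"
      using set_nths_subset[of as S] by auto
    have d: "distinct (nths as S @ ds)"
      using dist set_nths_subset[of as S] by auto
    have i: "V.independent (set (nths as S @ ds))"
      using V.independent_mono[OF ind sub] .
    have nz: "?H \<noteq> 0"
      using d i by (rule ext_prod_nonzero)
    have sp: "extensor_space scaleV scaleE \<iota> ?H = V.span (set (nths as S @ ds))"
      using extensor_space_ext_prod[of 1 "nths as S @ ds"] nz by (simp del: ext_prod_simps)
    have "extensor scaleE \<iota> ?H"
      using nz by (rule extensor_ext_prod)
    moreover have "{i. i < length as \<and> i \<in> S} = S"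
      using S by (auto simp: k_subsets_def)
    then have "length (nths as S) = m"
      using S by (simp add: length_nths k_subsets_def)
    then have "V.dim (V.span (set (nths as S @ ds))) = length ds + m"
      using V.dim_span_eq_card_independent[OF i] distinct_card[OF d] by simp
    moreover have "V.span (set ds) \<subseteq> V.span (set (nths as S @ ds))"
      by (rule V.span_mono) auto
    moreover have "V.span (set (nths as S @ ds)) \<subseteq> V.span (set (as @ ds))"
      by (rule V.span_mono[OF sub])
    ultimately show ?thesis
      unfolding sp[symmetric] by blast
  qed
  then have "?Y \<subseteq> E.span ?X"
    using E.span_base by blast
  with 1 show ?thesis
    by (simp add: E.span_eq)
qed

text \<open>
  Left multiplication by the product of \<open>as\<close> over the complement of \<open>S0\<close> repeats a vector for each
  other index set of the same size, because that set is not contained in \<open>S0\<close>. For \<open>S0\<close> itself it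
  yields a product of all vectors, which is nonzero and on which some functional takes the value \<open>1\<close>.
\<close>

lemma dual_functional:
  assumes dist: "distinct (as @ ds)" and ind: "V.independent (set (as @ ds))"
    and S0: "S0 \<in> k_subsets (length as) m"
  shows "\<exists>\<phi>. Vector_Spaces.linear scaleE (*) \<phi> \<and>
    (\<forall>S\<in>k_subsets (length as) m. \<phi> (ext_prod \<iota> (nths as S @ ds)) = (if S = S0 then 1 else 0))"
proof -
  let ?R = "nths as ({..<length as} - S0)"
  let ?top = "ext_prod \<iota> (?R @ nths as S0 @ ds)"
  have set_R: "set ?R = {as ! i | i. i < length as \<and> i \<notin> S0}"
    by (auto simp: set_nths)
  have nth_eq: "as ! i = as ! j \<longleftrightarrow> i = j" if "i < length as" "j < length as" for i j
    using dist that by (simp add: nth_eq_iff_index_eq)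
  have "distinct (?R @ nths as S0 @ ds)"
    using dist set_nths_subset[of as] by (fastforce simp: set_nths nth_eq)
  moreover have "V.independent (set (?R @ nths as S0 @ ds))"
    by (rule V.independent_mono[OF ind]) (auto dest: in_set_nthsD)
  ultimately have "?top \<noteq> 0"
    by (rule ext_prod_nonzero)
  then obtain g where g: "Vector_Spaces.linear scaleE (*) g" and g1: "g ?top = 1"
    using E.exists_functional[of "{?top}" "\<lambda>_. 1"] by (auto simp del: ext_prod_simps)
  interpret g: Vector_Spaces.linear scaleE "(*)" g by (rule g)
  have "Vector_Spaces.linear scaleE (*) (\<lambda>x. g (ext_prod \<iota> ?R * x))"
    by unfold_locales (simp_all add: distrib_left g.add scale_mult_right g.scale)
  moreover have "g (ext_prod \<iota> ?R * ext_prod \<iota> (nths as S @ ds)) = (if S = S0 then 1 else 0)"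
    if S: "S \<in> k_subsets (length as) m" for S
  proof (cases "S = S0")
    case False
    have fin: "finite S" "finite S0"
      using S S0 finite_subset unfolding k_subsets_def by blast+
    have "\<not> S \<subseteq> S0"
      using False card_subset_eq[OF fin(2)] S S0 by (auto simp: k_subsets_def)
    then obtain i where "i \<in> S" "i \<notin> S0"
      by blast
    then have "as ! i \<in> set ?R \<inter> set (nths as S)"
      using S by (auto simp: k_subsets_def set_nths)
    then have "\<not> distinct (?R @ nths as S @ ds)"
      by auto
    then have "ext_prod \<iota> (?R @ nths as S @ ds) = 0"
      using ext_prod_nonzero_iff by blast
    then show ?thesis
      using False by (simp add: g.zero)
  qed (use g1 in simp)
  ultimately show ?thesis
    by blast
qed

end

section \<open>Left and right spans of a tensor\<close>

context tensor_product
begin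

lemma relator_zero:
  assumes "r \<in> tensor_relators scaleX scaleY"
  shows "lin_extend scaleT (\<lambda>(x, y). tensor x y) r = 0"
  using presented free.span_base[OF assms] unfolding presented_by_def by blast

lemma linear_tensor_left: "Vector_Spaces.linear scaleX scaleT (\<lambda>x. tensor x y)"
proof -
  interpret ev: Vector_Spaces.linear free_scale scaleT "lin_extend scaleT (\<lambda>(x, y). tensor x y)"
    by (rule T.linear_lin_extend)
  show ?thesis
  proof unfold_locales
    fix x x'
    have "Poly_Mapping.single (x + x', y) 1 - Poly_Mapping.single (x, y) 1
        - Poly_Mapping.single (x', y) 1 \<in> tensor_relators scaleX scaleY"
      unfolding tensor_relators_def by blast
    from relator_zero[OF this] show "tensor (x + x') y = tensor x y + tensor x' y"
      by (simp add: ev.diff diff_eq_eq add.commute)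
  next
    fix c x
    have "Poly_Mapping.single (scaleX c x, y) 1 - Poly_Mapping.single (x, y) c
        \<in> tensor_relators scaleX scaleY"
      unfolding tensor_relators_def by blast
    from relator_zero[OF this] show "tensor (scaleX c x) y = scaleT c (tensor x y)"
      by (simp add: ev.diff)
  qed
qed

lemma linear_tensor_right: "Vector_Spaces.linear scaleY scaleT (tensor x)"
proof -
  interpret ev: Vector_Spaces.linear free_scale scaleT "lin_extend scaleT (\<lambda>(x, y). tensor x y)"
    by (rule T.linear_lin_extend)
  show ?thesis
  proof unfold_locales
    fix y y'
    have "Poly_Mapping.single (x, y + y') 1 - Poly_Mapping.single (x, y) 1
        - Poly_Mapping.single (x, y') 1 \<in> tensor_relators scaleX scaleY"
      unfolding tensor_relators_def by blast
    from relator_zero[OF this] show "tensor x (y + y') = tensor x y + tensor x y'"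
      by (simp add: ev.diff diff_eq_eq add.commute)
  next
    fix c y
    have "Poly_Mapping.single (x, scaleY c y) 1 - Poly_Mapping.single (x, y) c
        \<in> tensor_relators scaleX scaleY"
      unfolding tensor_relators_def by blast
    from relator_zero[OF this] show "tensor x (scaleY c y) = scaleT c (tensor x y)"
      by (simp add: ev.diff)
  qed
qed

sublocale tl: Vector_Spaces.linear scaleX scaleT "\<lambda>x. tensor x y" for y
  by (rule linear_tensor_left)

sublocale tr: Vector_Spaces.linear scaleY scaleT "tensor x" for x
  by (rule linear_tensor_right)

lemma linear_eq_on_pure:
  assumes F: "Vector_Spaces.linear scaleT scaleU F" and G: "Vector_Spaces.linear scaleT scaleU G"
    and eq: "\<And>x y. F (tensor x y) = G (tensor x y)"
  shows "F = G"
proof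
  fix t
  interpret F: Vector_Spaces.linear scaleT scaleU F by (rule F)
  interpret G: Vector_Spaces.linear scaleT scaleU G by (rule G)
  obtain p where p: "lin_extend scaleT (\<lambda>(x, y). tensor x y) p = t"
    using presented unfolding presented_by_def by blast
  show "F t = G t"
    unfolding p[symmetric] lin_extend_def
    by (simp add: F.sum G.sum F.scale G.scale eq case_prod_beta)
qed

text \<open>
  The given sum is a representation with left span contained in the right-hand side. Conversely, a
  functional \<open>\<phi>\<close> dual to \<open>y S\<^sub>0\<close> induces the contraction \<open>x \<otimes> y \<mapsto> \<phi>(y) x\<close>. It
  maps \<open>t\<close> to a nonzero multiple of \<open>x S\<^sub>0\<close>, and it maps any representation of \<open>t\<close> into the
  span of the left factors of that representation.
\<close>

lemma left_span_eq:
  assumes K: "finite K" and t: "t = (\<Sum>S\<in>K. scaleT (c S) (tensor (x S) (y S)))"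
    and c: "\<And>S. S \<in> K \<Longrightarrow> c S \<noteq> 0"
    and dual: "\<And>S\<^sub>0. S\<^sub>0 \<in> K \<Longrightarrow> \<exists>\<phi>. Vector_Spaces.linear scaleY (*) \<phi> \<and>
      (\<forall>S\<in>K. \<phi> (y S) = (if S = S\<^sub>0 then 1 else 0))"
  shows "left_span scaleX tensor t = X.span (x ` K)"
proof
  obtain ks where ks: "distinct ks" "set ks = K"
    using finite_distinct_list[OF K] by blast
  define xys where "xys = map (\<lambda>S. (scaleX (c S) (x S), y S)) ks"
  have "t = (\<Sum>(x, y)\<leftarrow>xys. tensor x y)"
    using ks t by (simp add: xys_def o_def tl.scale sum_list_distinct_conv_sum_set)
  then have "left_span scaleX tensor t \<subseteq> X.span (set (map fst xys))"
    unfolding left_span_def by blast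
  also have "\<dots> \<subseteq> X.span (x ` K)"
    by (rule X.span_minimal) (auto simp: xys_def ks intro: X.span_scale X.span_base)
  finally show "left_span scaleX tensor t \<subseteq> X.span (x ` K)" .
next
  have "x S\<^sub>0 \<in> X.span (set (map fst xys))"
    if S0: "S\<^sub>0 \<in> K" and rep: "t = (\<Sum>(x, y)\<leftarrow>xys. tensor x y)" for S\<^sub>0 xys
  proof -
    obtain \<phi> where \<phi>: "Vector_Spaces.linear scaleY (*) \<phi>"
      and dual\<phi>: "\<And>S. S \<in> K \<Longrightarrow> \<phi> (y S) = (if S = S\<^sub>0 then 1 else 0)"
      using dual[OF S0] by blast
    interpret \<phi>: Vector_Spaces.linear scaleY "(*)" \<phi> by (rule \<phi>)
    have "\<exists>!\<Phi>. Vector_Spaces.linear scaleT scaleX \<Phi> \<and> (\<forall>x y. \<Phi> (tensor x y) = scaleX (\<phi> y) x)"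
      by (rule universal; unfold_locales)
        (simp_all add: \<phi>.add \<phi>.scale X.scale_left_distrib X.scale_right_distrib mult.commute)
    then obtain \<Phi> where \<Phi>: "Vector_Spaces.linear scaleT scaleX \<Phi>"
      and \<Phi>_tensor: "\<And>x y. \<Phi> (tensor x y) = scaleX (\<phi> y) x"
      by blast
    interpret \<Phi>: Vector_Spaces.linear scaleT scaleX \<Phi> by (rule \<Phi>)
    have "\<Phi> t = (\<Sum>S\<in>K. scaleX (c S * \<phi> (y S)) (x S))"
      by (simp add: t \<Phi>.sum \<Phi>.scale \<Phi>_tensor)
    also have "\<dots> = (\<Sum>S\<in>K. if S = S\<^sub>0 then scaleX (c S\<^sub>0) (x S\<^sub>0) else 0)"
      by (rule sum.cong) (simp_all add: dual\<phi>)
    also have "\<dots> = scaleX (c S\<^sub>0) (x S\<^sub>0)"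
      using K S0 by simp
    finally have 1: "x S\<^sub>0 = scaleX (inverse (c S\<^sub>0)) (\<Phi> t)"
      using c[OF S0] by simp
    have "\<Phi> (\<Sum>(x, y)\<leftarrow>xys. tensor x y) \<in> X.span (set (map fst xys))"
    proof (induction xys)
      case (Cons xy xys)
      have "X.span (set (map fst xys)) \<subseteq> X.span (set (map fst (xy # xys)))"
        by (rule X.span_mono) auto
      with Cons have 2: "\<Phi> (\<Sum>(x, y)\<leftarrow>xys. tensor x y) \<in> X.span (set (map fst (xy # xys)))"
        by blast
      have "scaleX (\<phi> (snd xy)) (fst xy) \<in> X.span (set (map fst (xy # xys)))"
        by (intro X.span_scale X.span_base) simp
      from X.span_add[OF this 2] show ?case
        by (cases xy) (simp add: \<Phi>.add \<Phi>_tensor)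
    qed (simp add: \<Phi>.zero X.span_zero)
    then show ?thesis
      unfolding 1 rep by (rule X.span_scale)
  qed
  then have "x ` K \<subseteq> X.span (set (map fst xys))" if "t = (\<Sum>(x, y)\<leftarrow>xys. tensor x y)" for xys
    using that by blast
  then have "X.span (x ` K) \<subseteq> X.span (set (map fst xys))"
    if "t = (\<Sum>(x, y)\<leftarrow>xys. tensor x y)" for xys
    using that by (intro X.span_minimal) auto
  then show "X.span (x ` K) \<subseteq> left_span scaleX tensor t"
    unfolding left_span_def by blast
qed

text \<open>
  The mirror image of the preceding lemma: functionals dual to the left factors recover the right ones.
\<close>

lemma right_span_eq:
  assumes K: "finite K" and t: "t = (\<Sum>S\<in>K. scaleT (c S) (tensor (x S) (y S)))"
    and c: "\<And>S. S \<in> K \<Longrightarrow> c S \<noteq> 0"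
    and dual: "\<And>S\<^sub>0. S\<^sub>0 \<in> K \<Longrightarrow> \<exists>\<phi>. Vector_Spaces.linear scaleX (*) \<phi> \<and>
      (\<forall>S\<in>K. \<phi> (x S) = (if S = S\<^sub>0 then 1 else 0))"
  shows "right_span scaleY tensor t = Y.span (y ` K)"
proof
  obtain ks where ks: "distinct ks" "set ks = K"
    using finite_distinct_list[OF K] by blast
  define xys where "xys = map (\<lambda>S. (x S, scaleY (c S) (y S))) ks"
  have "t = (\<Sum>(x, y)\<leftarrow>xys. tensor x y)"
    using ks t by (simp add: xys_def o_def tr.scale sum_list_distinct_conv_sum_set)
  then have "right_span scaleY tensor t \<subseteq> Y.span (set (map snd xys))"
    unfolding right_span_def by blast
  also have "\<dots> \<subseteq> Y.span (y ` K)"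
    by (rule Y.span_minimal) (auto simp: xys_def ks intro: Y.span_scale Y.span_base)
  finally show "right_span scaleY tensor t \<subseteq> Y.span (y ` K)" .
next
  have "y S\<^sub>0 \<in> Y.span (set (map snd xys))"
    if S0: "S\<^sub>0 \<in> K" and rep: "t = (\<Sum>(x, y)\<leftarrow>xys. tensor x y)" for S\<^sub>0 xys
  proof -
    obtain \<phi> where \<phi>: "Vector_Spaces.linear scaleX (*) \<phi>"
      and dual\<phi>: "\<And>S. S \<in> K \<Longrightarrow> \<phi> (x S) = (if S = S\<^sub>0 then 1 else 0)"
      using dual[OF S0] by blast
    interpret \<phi>: Vector_Spaces.linear scaleX "(*)" \<phi> by (rule \<phi>)
    have "\<exists>!\<Phi>. Vector_Spaces.linear scaleT scaleY \<Phi> \<and> (\<forall>x y. \<Phi> (tensor x y) = scaleY (\<phi> x) y)"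
      by (rule universal; unfold_locales)
        (simp_all add: \<phi>.add \<phi>.scale Y.scale_left_distrib Y.scale_right_distrib mult.commute)
    then obtain \<Phi> where \<Phi>: "Vector_Spaces.linear scaleT scaleY \<Phi>"
      and \<Phi>_tensor: "\<And>x y. \<Phi> (tensor x y) = scaleY (\<phi> x) y"
      by blast
    interpret \<Phi>: Vector_Spaces.linear scaleT scaleY \<Phi> by (rule \<Phi>)
    have "\<Phi> t = (\<Sum>S\<in>K. scaleY (c S * \<phi> (x S)) (y S))"
      by (simp add: t \<Phi>.sum \<Phi>.scale \<Phi>_tensor)
    also have "\<dots> = (\<Sum>S\<in>K. if S = S\<^sub>0 then scaleY (c S\<^sub>0) (y S\<^sub>0) else 0)"
      by (rule sum.cong) (simp_all add: dual\<phi>)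
    also have "\<dots> = scaleY (c S\<^sub>0) (y S\<^sub>0)"
      using K S0 by simp
    finally have 1: "y S\<^sub>0 = scaleY (inverse (c S\<^sub>0)) (\<Phi> t)"
      using c[OF S0] by simp
    have "\<Phi> (\<Sum>(x, y)\<leftarrow>xys. tensor x y) \<in> Y.span (set (map snd xys))"
    proof (induction xys)
      case (Cons xy xys)
      have "Y.span (set (map snd xys)) \<subseteq> Y.span (set (map snd (xy # xys)))"
        by (rule Y.span_mono) auto
      with Cons have 2: "\<Phi> (\<Sum>(x, y)\<leftarrow>xys. tensor x y) \<in> Y.span (set (map snd (xy # xys)))"
        by blast
      have "scaleY (\<phi> (fst xy)) (snd xy) \<in> Y.span (set (map snd (xy # xys)))"
        by (intro Y.span_scale Y.span_base) simp
      from Y.span_add[OF this 2] show ?case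
        by (cases xy) (simp add: \<Phi>.add \<Phi>_tensor)
    qed (simp add: \<Phi>.zero Y.span_zero)
    then show ?thesis
      unfolding 1 rep by (rule Y.span_scale)
  qed
  then have "y ` K \<subseteq> Y.span (set (map snd xys))" if "t = (\<Sum>(x, y)\<leftarrow>xys. tensor x y)" for xys
    using that by blast
  then have "Y.span (y ` K) \<subseteq> Y.span (set (map snd xys))"
    if "t = (\<Sum>(x, y)\<leftarrow>xys. tensor x y)" for xys
    using that by (intro Y.span_minimal) auto
  then show "Y.span (y ` K) \<subseteq> right_span scaleY tensor t"
    unfolding right_span_def by blast
qed

end

section \<open>Coproduct slices as linear maps\<close>

context vector_space
begin

lemma slice_sum_add:
  "slice_sum scale \<iota> i j vs (\<lambda>a b. \<beta> a b + \<gamma> a b) = slice_sum scale \<iota> i j vs \<beta> + slice_sum scale \<iota> i j vs \<gamma>"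
  by (simp add: slice_sum_def scale_right_distrib sum.distrib)

lemma slice_sum_scale:
  "slice_sum scale \<iota> i j vs (\<lambda>a b. scale c (\<beta> a b)) = scale c (slice_sum scale \<iota> i j vs \<beta>)"
  by (simp add: slice_sum_def scale_sum_right mult.commute)

lemma slice_sum_zero: "slice_sum scale \<iota> i j vs (\<lambda>a b. 0) = 0"
  by (simp add: slice_sum_def)

end

definition bilinear_map ::
  "('k::field \<Rightarrow> 'x \<Rightarrow> 'x) \<Rightarrow> ('k \<Rightarrow> 'y \<Rightarrow> 'y) \<Rightarrow> ('k \<Rightarrow> 't \<Rightarrow> 't) \<Rightarrow>
   ('x::ab_group_add \<Rightarrow> 'y::ab_group_add \<Rightarrow> 't::ab_group_add) \<Rightarrow> bool" where
  "bilinear_map scaleX scaleY scaleT \<beta> \<longleftrightarrow>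
     (\<forall>y. Vector_Spaces.linear scaleX scaleT (\<lambda>x. \<beta> x y)) \<and>
     (\<forall>x. Vector_Spaces.linear scaleY scaleT (\<beta> x))"

lemma bilinear_mapD:
  assumes "bilinear_map scaleX scaleY scaleT \<beta>"
  shows "\<beta> (x + x') y = \<beta> x y + \<beta> x' y" "\<beta> x (y + y') = \<beta> x y + \<beta> x y'"
    "\<beta> (scaleX c x) y = scaleT c (\<beta> x y)" "\<beta> x (scaleY c y) = scaleT c (\<beta> x y)"
    "\<beta> 0 y = 0" "\<beta> x 0 = 0"
proof -
  interpret l: Vector_Spaces.linear scaleX scaleT "\<lambda>x. \<beta> x y" for y
    using assms by (simp add: bilinear_map_def)
  interpret r: Vector_Spaces.linear scaleY scaleT "\<beta> x" for x
    using assms by (simp add: bilinear_map_def)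
  show "\<beta> (x + x') y = \<beta> x y + \<beta> x' y" "\<beta> x (y + y') = \<beta> x y + \<beta> x y'"
    "\<beta> (scaleX c x) y = scaleT c (\<beta> x y)" "\<beta> x (scaleY c y) = scaleT c (\<beta> x y)"
    "\<beta> 0 y = 0" "\<beta> x 0 = 0"
    by (simp_all add: l.add l.scale l.zero r.add r.scale r.zero)
qed

lemma bilinear_mapI:
  assumes "vector_space scaleX" "vector_space scaleY" "vector_space scaleT"
    and "\<And>x x' y. \<beta> (x + x') y = \<beta> x y + \<beta> x' y"
    and "\<And>x y y'. \<beta> x (y + y') = \<beta> x y + \<beta> x y'"
    and "\<And>c x y. \<beta> (scaleX c x) y = scaleT c (\<beta> x y)"
    and "\<And>c x y. \<beta> x (scaleY c y) = scaleT c (\<beta> x y)"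
  shows "bilinear_map scaleX scaleY scaleT \<beta>"
  unfolding bilinear_map_def using assms
  by (auto intro!: Vector_Spaces.linear.intro module_hom.intro module_hom_axioms.intro
      simp: module_iff_vector_space)

context exterior_algebra
begin

interpretation \<iota>: Vector_Spaces.linear scaleV scaleE \<iota>
  by (rule linear_\<iota>)

context
  fixes scaleT :: "'k \<Rightarrow> 't::ab_group_add \<Rightarrow> 't"
  assumes T: "vector_space scaleT"
begin

interpretation T: vector_space scaleT by (rule T)

lemma bilinear_map_mult:
  assumes "bilinear_map scaleE scaleE scaleT \<beta>"
  shows "bilinear_map scaleE scaleE scaleT (\<lambda>a b. \<beta> (x * a) b)"
    and "bilinear_map scaleE scaleE scaleT (\<lambda>a b. \<beta> a (x * b))"
  by (rule bilinear_mapI[OF E.vector_space_axioms E.vector_space_axioms T];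
      simp add: distrib_left scale_mult_right bilinear_mapD[OF assms])+

lemma slice_sum_word_add:
  assumes "bilinear_map scaleE scaleE scaleT \<beta>"
  shows "slice_sum scaleT \<iota> i j (xs @ (u + v) # ys) \<beta> =
    slice_sum scaleT \<iota> i j (xs @ u # ys) \<beta> + slice_sum scaleT \<iota> i j (xs @ v # ys) \<beta>"
  using assms
proof (induction xs arbitrary: i j \<beta>)
  case Nil
  show ?case
    by (simp add: T.slice_sum_Cons \<iota>.add distrib_right bilinear_mapD[OF Nil] T.slice_sum_add
        T.scale_right_distrib)
next
  case (Cons x xs)
  show ?case
    using Cons.IH[OF bilinear_map_mult(1)[OF Cons.prems]]
      Cons.IH[OF bilinear_map_mult(2)[OF Cons.prems]]
    by (simp add: T.slice_sum_Cons T.scale_right_distrib)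
qed

lemma slice_sum_word_scale:
  assumes "bilinear_map scaleE scaleE scaleT \<beta>"
  shows "slice_sum scaleT \<iota> i j (xs @ scaleV c v # ys) \<beta> =
    scaleT c (slice_sum scaleT \<iota> i j (xs @ v # ys) \<beta>)"
  using assms
proof (induction xs arbitrary: i j \<beta>)
  case Nil
  show ?case
    by (simp add: T.slice_sum_Cons \<iota>.scale scale_mult_left bilinear_mapD[OF Nil] T.slice_sum_scale
        T.scale_right_distrib mult.commute)
next
  case (Cons x xs)
  show ?case
    using Cons.IH[OF bilinear_map_mult(1)[OF Cons.prems]]
      Cons.IH[OF bilinear_map_mult(2)[OF Cons.prems]]
    by (simp add: T.slice_sum_Cons T.scale_right_distrib mult.commute)
qed

text \<open>
  Expanding along both copies of \<open>v\<close>, the two terms with \<open>v\<close> twice on one side vanish, and the two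
  terms with one \<open>v\<close> on each side have opposite signs.
\<close>

lemma slice_sum_word_square:
  assumes "bilinear_map scaleE scaleE scaleT \<beta>"
  shows "slice_sum scaleT \<iota> i j (xs @ v # v # ys) \<beta> = 0"
  using assms
proof (induction xs arbitrary: i j \<beta>)
  case Nil
  have "(-1 :: 'k) powi (i - 1) = - ((-1) powi i)"
    by (simp add: power_int_diff)
  then show ?case
    by (simp add: T.slice_sum_Cons \<iota>_square_left bilinear_mapD[OF Nil] T.slice_sum_zero)
next
  case (Cons x xs)
  show ?case
    using Cons.IH[OF bilinear_map_mult(1)[OF Cons.prems]]
      Cons.IH[OF bilinear_map_mult(2)[OF Cons.prems]]
    by (simp add: T.slice_sum_Cons)
qed

text \<open>
  The degrees may depend on the length of the word, because all words in a relator have the same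
  length. This covers the slices \<open>(a - h, h)\<close>, where \<open>a\<close> is the
  step of the extensor.
\<close>

lemma slice_sum_linear:
  assumes "bilinear_map scaleE scaleE scaleT \<beta>"
  shows "\<exists>F. Vector_Spaces.linear scaleE scaleT F \<and>
    (\<forall>vs. F (ext_prod \<iota> vs) = slice_sum scaleT \<iota> (i (length vs)) (j (length vs)) vs \<beta>)"
  by (rule linear_from_words)
    (simp_all add: T slice_sum_word_add[OF assms] slice_sum_word_scale[OF assms]
      slice_sum_word_square[OF assms])

text \<open>
  A parameter \<open>B\<close> on which the bilinear map depends linearly turns the family of linear maps of the
  preceding lemma into a bilinear map, since a linear map is determined by its values on words.
\<close>

lemma slice_sum_bilinear:
  fixes \<gamma> :: "'e \<Rightarrow> 'e \<Rightarrow> 'e \<Rightarrow> 't"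
  assumes bil: "\<And>B. bilinear_map scaleE scaleE scaleT (\<gamma> B)"
    and lin: "\<And>a b. Vector_Spaces.linear scaleE scaleT (\<lambda>B. \<gamma> B a b)"
  obtains \<Phi> where "\<And>B. Vector_Spaces.linear scaleE scaleT (\<lambda>A. \<Phi> A B)"
    and "\<And>A. Vector_Spaces.linear scaleE scaleT (\<Phi> A)"
    and "\<And>vs B. \<Phi> (ext_prod \<iota> vs) B = slice_sum scaleT \<iota> (i (length vs)) (j (length vs)) vs (\<gamma> B)"
proof -
  obtain F where F: "\<And>B. Vector_Spaces.linear scaleE scaleT (F B)"
    and F_word: "\<And>B vs. F B (ext_prod \<iota> vs) =
      slice_sum scaleT \<iota> (i (length vs)) (j (length vs)) vs (\<gamma> B)"
    using slice_sum_linear[OF bil] by metis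
  interpret F: Vector_Spaces.linear scaleE scaleT "F B" for B by (rule F)
  interpret \<gamma>: Vector_Spaces.linear scaleE scaleT "\<lambda>B. \<gamma> B a b" for a b by (rule lin)
  have "F (B + B') = (\<lambda>A. F B A + F B' A)" for B B'
  proof (rule linear_eq_on_words[OF F])
    show "Vector_Spaces.linear scaleE scaleT (\<lambda>A. F B A + F B' A)"
      by unfold_locales (simp_all add: F.add F.scale T.scale_right_distrib)
    have "\<gamma> (B + B') = (\<lambda>a b. \<gamma> B a b + \<gamma> B' a b)"
      by (intro ext) (rule \<gamma>.add)
    then show "F (B + B') (ext_prod \<iota> vs) = F B (ext_prod \<iota> vs) + F B' (ext_prod \<iota> vs)" for vs
      by (simp add: F_word T.slice_sum_add)
  qed
  moreover have "F (scaleE c B) = (\<lambda>A. scaleT c (F B A))" for c B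
  proof (rule linear_eq_on_words[OF F])
    show "Vector_Spaces.linear scaleE scaleT (\<lambda>A. scaleT c (F B A))"
      by unfold_locales (simp_all add: F.add F.scale T.scale_right_distrib mult.commute)
    have "\<gamma> (scaleE c B) = (\<lambda>a b. scaleT c (\<gamma> B a b))"
      by (intro ext) (rule \<gamma>.scale)
    then show "F (scaleE c B) (ext_prod \<iota> vs) = scaleT c (F B (ext_prod \<iota> vs))" for vs
      by (simp add: F_word T.slice_sum_scale)
  qed
  ultimately have "Vector_Spaces.linear scaleE scaleT (\<lambda>B. F B A)" for A
    by unfold_locales simp_all
  with F F_word show ?thesis
    by (intro that[of "\<lambda>A B. F B A"])
qed

end
end

section \<open>The geometric products are well defined\<close>

locale exterior_tensor_square =
  exterior_algebra scaleV scaleE \<iota> + TP: tensor_product scaleE scaleE scaleT tensor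
  for scaleV :: "'k::field \<Rightarrow> 'v::ab_group_add \<Rightarrow> 'v"
    and scaleE :: "'k \<Rightarrow> 'e::ring_1 \<Rightarrow> 'e" and \<iota> :: "'v \<Rightarrow> 'e"
    and scaleT :: "'k \<Rightarrow> 't::ab_group_add \<Rightarrow> 't" and tensor :: "'e \<Rightarrow> 'e \<Rightarrow> 't"
begin

lemma linear_eq_on_extensors:
  assumes F: "Vector_Spaces.linear scaleT scaleU F" and G: "Vector_Spaces.linear scaleT scaleU G"
    and eq: "\<And>vs ws. extensor scaleE \<iota> (ext_prod \<iota> vs) \<Longrightarrow> extensor scaleE \<iota> (ext_prod \<iota> ws) \<Longrightarrow>
      F (tensor (ext_prod \<iota> vs) (ext_prod \<iota> ws)) = G (tensor (ext_prod \<iota> vs) (ext_prod \<iota> ws))"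
  shows "F = G"
proof (rule TP.linear_eq_on_pure[OF F G])
  interpret F: Vector_Spaces.linear scaleT scaleU F by (rule F)
  interpret G: Vector_Spaces.linear scaleT scaleU G by (rule G)
  have "F (tensor (ext_prod \<iota> vs) (ext_prod \<iota> ws)) = G (tensor (ext_prod \<iota> vs) (ext_prod \<iota> ws))"
    for vs ws
    using eq[of vs ws] extensor_ext_prod[of vs] extensor_ext_prod[of ws]
    by (cases "ext_prod \<iota> vs = 0"; cases "ext_prod \<iota> ws = 0")
      (simp_all add: TP.tl.zero TP.tr.zero F.zero G.zero)
  then have "(\<lambda>y. F (tensor (ext_prod \<iota> vs) y)) = (\<lambda>y. G (tensor (ext_prod \<iota> vs) y))" for vs
    by (intro linear_eq_on_words[where scaleU = scaleU]; (unfold_locales)?)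
      (simp_all add: TP.tr.add TP.tr.scale F.add F.scale G.add G.scale)
  then have "(\<lambda>x. F (tensor x y)) = (\<lambda>x. G (tensor x y))" for y
    by (intro linear_eq_on_words[where scaleU = scaleU]; (unfold_locales)?)
      (simp_all add: TP.tl.add TP.tl.scale F.add F.scale G.add G.scale fun_eq_iff)
  then show "F (tensor x y) = G (tensor x y)" for x y
    by metis
qed

text \<open>
  The defining formula, required for extensors only, determines a linear operator, and the operator
  induced by the bilinear map of the preceding section satisfies it for arbitrary words and arbitrary \<open>B\<close>.
\<close>

lemma diamond21_well_defined:
  defines "D h \<equiv> diamond21 scaleE scaleT \<iota> tensor h"
  shows "Vector_Spaces.linear scaleT scaleT (D h)"
    and "D h (tensor (ext_prod \<iota> vs) B) =
      slice_sum scaleT \<iota> (int (length vs) - int h) (int h) vs (\<lambda>A1 A2. tensor A1 (A2 * B))"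
proof -
  have "bilinear_map scaleE scaleE scaleT (\<lambda>a b. tensor a (b * B))" for B
    by (rule bilinear_mapI[OF E.vector_space_axioms E.vector_space_axioms TP.T.vector_space_axioms])
      (simp_all add: distrib_right scale_mult_left TP.tl.add TP.tl.scale TP.tr.add TP.tr.scale)
  moreover have "Vector_Spaces.linear scaleE scaleT (\<lambda>B. tensor a (b * B))" for a b
    by unfold_locales (simp_all add: distrib_left scale_mult_right TP.tr.add TP.tr.scale)
  ultimately obtain \<Phi> where \<Phi>: "\<And>B. Vector_Spaces.linear scaleE scaleT (\<lambda>A. \<Phi> A B)"
      "\<And>A. Vector_Spaces.linear scaleE scaleT (\<Phi> A)"
    and \<Phi>_word: "\<And>vs B. \<Phi> (ext_prod \<iota> vs) B =
      slice_sum scaleT \<iota> (int (length vs) - int h) (int h) vs (\<lambda>A1 A2. tensor A1 (A2 * B))"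
    using slice_sum_bilinear[OF TP.T.vector_space_axioms,
        of "\<lambda>B a b. tensor a (b * B)" "\<lambda>n. int n - int h" "\<lambda>n. int h"] by blast
  from TP.universal[OF TP.T.vector_space_axioms \<Phi>] obtain D'
    where D': "Vector_Spaces.linear scaleT scaleT D'" "\<And>x y. D' (tensor x y) = \<Phi> x y"
    by blast
  have "D h = D'"
    unfolding D_def diamond21_def
  proof (rule the_equality)
    fix D'' assume D'': "Vector_Spaces.linear scaleT scaleT D'' \<and>
        (\<forall>vs B. extensor scaleE \<iota> (ext_prod \<iota> vs) \<longrightarrow> extensor scaleE \<iota> B \<longrightarrow>
           D'' (tensor (ext_prod \<iota> vs) B) =
             slice_sum scaleT \<iota> (int (length vs) - int h) (int h) vs
               (\<lambda>A1 A2. tensor A1 (A2 * B)))"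
    then show "D'' = D'"
      by (intro linear_eq_on_extensors[OF _ D'(1)]) (simp_all add: D' \<Phi>_word)
  qed (simp add: D' \<Phi>_word)
  then show "Vector_Spaces.linear scaleT scaleT (D h)"
    and "D h (tensor (ext_prod \<iota> vs) B) =
      slice_sum scaleT \<iota> (int (length vs) - int h) (int h) vs (\<lambda>A1 A2. tensor A1 (A2 * B))"
    by (simp_all add: D' \<Phi>_word)
qed

lemma diamond12_well_defined:
  defines "D h \<equiv> diamond12 scaleE scaleT \<iota> tensor h"
  shows "Vector_Spaces.linear scaleT scaleT (D h)"
    and "D h (tensor A (ext_prod \<iota> vs)) =
      slice_sum scaleT \<iota> (int h) (int (length vs) - int h) vs (\<lambda>B1 B2. tensor (A * B1) B2)"
proof -
  have "bilinear_map scaleE scaleE scaleT (\<lambda>a b. tensor (A * a) b)" for A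
    by (rule bilinear_mapI[OF E.vector_space_axioms E.vector_space_axioms TP.T.vector_space_axioms])
      (simp_all add: distrib_left scale_mult_right TP.tl.add TP.tl.scale TP.tr.add TP.tr.scale)
  moreover have "Vector_Spaces.linear scaleE scaleT (\<lambda>A. tensor (A * a) b)" for a b
    by unfold_locales (simp_all add: distrib_right scale_mult_left TP.tl.add TP.tl.scale)
  ultimately obtain \<Phi> where \<Phi>: "\<And>A. Vector_Spaces.linear scaleE scaleT (\<lambda>B. \<Phi> B A)"
      "\<And>B. Vector_Spaces.linear scaleE scaleT (\<Phi> B)"
    and \<Phi>_word: "\<And>vs A. \<Phi> (ext_prod \<iota> vs) A =
      slice_sum scaleT \<iota> (int h) (int (length vs) - int h) vs (\<lambda>B1 B2. tensor (A * B1) B2)"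
    using slice_sum_bilinear[OF TP.T.vector_space_axioms,
        of "\<lambda>A a b. tensor (A * a) b" "\<lambda>n. int h" "\<lambda>n. int n - int h"] by blast
  from TP.universal[OF TP.T.vector_space_axioms \<Phi>(2,1)] obtain D'
    where D': "Vector_Spaces.linear scaleT scaleT D'" "\<And>x y. D' (tensor x y) = \<Phi> y x"
    by blast
  have "D h = D'"
    unfolding D_def diamond12_def
  proof (rule the_equality)
    fix D'' assume D'': "Vector_Spaces.linear scaleT scaleT D'' \<and>
        (\<forall>A vs. extensor scaleE \<iota> A \<longrightarrow> extensor scaleE \<iota> (ext_prod \<iota> vs) \<longrightarrow>
           D'' (tensor A (ext_prod \<iota> vs)) =
             slice_sum scaleT \<iota> (int h) (int (length vs) - int h) vs
               (\<lambda>B1 B2. tensor (A * B1) B2))"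
    then show "D'' = D'"
      by (intro linear_eq_on_extensors[OF _ D'(1)]) (simp_all add: D' \<Phi>_word)
  qed (simp add: D' \<Phi>_word)
  then show "Vector_Spaces.linear scaleT scaleT (D h)"
    and "D h (tensor A (ext_prod \<iota> vs)) =
      slice_sum scaleT \<iota> (int h) (int (length vs) - int h) vs (\<lambda>B1 B2. tensor (A * B1) B2)"
    by (simp_all add: D' \<Phi>_word)
qed

end

section \<open>The geometric products in an adapted basis\<close>

context vector_space
begin

lemma of_int_shuffle_sign_nonzero: "of_int (shuffle_sign n I) \<noteq> (0 :: 'a)"
  by (simp add: shuffle_sign_def sign_def)

lemma slice_sum_k_subsets_left:
  fixes vs :: "'v list"
  defines "n \<equiv> length vs"
  shows "slice_sum scale \<iota> (int h) (int n - int h) vs \<beta> =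
    (\<Sum>I\<in>k_subsets n h. scale (of_int (shuffle_sign n I))
      (\<beta> (ext_prod \<iota> (nths vs I)) (ext_prod \<iota> (nths vs ({..<n} - I)))))"
proof -
  have "int (card ({..<n} - I)) = int n - int (card I)" if "I \<subseteq> {..<n}" for I
    using that card_mono[OF _ that] by (simp add: card_Diff_subset finite_subset of_nat_diff)
  then have "{I. I \<subseteq> {..<n} \<and> int (card I) = int h \<and>
      int (card ({..<n} - I)) = int n - int h} = k_subsets n h"
    by (auto simp: k_subsets_def)
  then show ?thesis
    by (simp add: slice_sum_def n_def)
qed

lemma slice_sum_k_subsets_right:
  fixes vs :: "'v list"
  defines "n \<equiv> length vs"
  shows "slice_sum scale \<iota> (int n - int h) (int h) vs \<beta> =
    (\<Sum>J\<in>k_subsets n h. scale (of_int (shuffle_sign n ({..<n} - J)))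
      (\<beta> (ext_prod \<iota> (nths vs ({..<n} - J))) (ext_prod \<iota> (nths vs J))))"
proof -
  have card: "int (card ({..<n} - I)) = int n - int (card I)" if "I \<subseteq> {..<n}" for I
    using that card_mono[OF _ that] by (simp add: card_Diff_subset finite_subset of_nat_diff)
  show ?thesis
    unfolding slice_sum_def n_def[symmetric]
    by (rule sum.reindex_bij_witness[of _ "\<lambda>J. {..<n} - J" "\<lambda>I. {..<n} - I"])
      (auto simp: k_subsets_def card double_diff)
qed

end

context exterior_tensor_square
begin

text \<open>
  Only the index sets contained in the positions of \<open>as\<close> contribute. The list \<open>cs\<close> comes last in
  the word, so that these are the sets of numbers below \<open>length as\<close>.
\<close>

lemma diamond21_adapted:
  fixes as cs :: "'v list"
  defines "p \<equiv> length as" and "n \<equiv> length (as @ cs)"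
  shows "diamond21 scaleE scaleT \<iota> tensor h (tensor (ext_prod \<iota> (as @ cs)) (ext_prod \<iota> (bs @ cs))) =
    (\<Sum>S\<in>k_subsets p h. scaleT (of_int (shuffle_sign n ({..<n} - S)))
      (tensor (ext_prod \<iota> (nths as ({..<p} - S) @ cs)) (ext_prod \<iota> (nths as S @ bs @ cs))))"
proof -
  let ?vs = "as @ cs"
  have zero: "ext_prod \<iota> (nths ?vs S @ bs @ cs) = 0" if "S \<in> k_subsets n h - k_subsets p h" for S
  proof -
    have "\<not> distinct (nths ?vs S @ bs @ cs)"
      using that nths_append_meets_right[of S as cs] by (auto simp: k_subsets_def p_def n_def)
    then show ?thesis
      using ext_prod_nonzero_iff by blast
  qed
  have "diamond21 scaleE scaleT \<iota> tensor h (tensor (ext_prod \<iota> ?vs) (ext_prod \<iota> (bs @ cs))) =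
    (\<Sum>S\<in>k_subsets n h. scaleT (of_int (shuffle_sign n ({..<n} - S)))
      (tensor (ext_prod \<iota> (nths ?vs ({..<n} - S))) (ext_prod \<iota> (nths ?vs S @ bs @ cs))))"
    unfolding diamond21_well_defined(2) TP.T.slice_sum_k_subsets_right n_def by simp
  also have "\<dots> = (\<Sum>S\<in>k_subsets p h. scaleT (of_int (shuffle_sign n ({..<n} - S)))
      (tensor (ext_prod \<iota> (nths ?vs ({..<n} - S))) (ext_prod \<iota> (nths ?vs S @ bs @ cs))))"
  proof (intro sum.mono_neutral_right ballI)
    show "k_subsets p h \<subseteq> k_subsets n h"
      by (auto simp: k_subsets_def p_def n_def)
    show "scaleT (of_int (shuffle_sign n ({..<n} - S)))
        (tensor (ext_prod \<iota> (nths ?vs ({..<n} - S))) (ext_prod \<iota> (nths ?vs S @ bs @ cs))) = 0"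
      if "S \<in> k_subsets n h - k_subsets p h" for S
      by (simp only: zero[OF that] TP.tr.zero TP.T.scale_zero_right)
  qed simp
  also have "\<dots> = (\<Sum>S\<in>k_subsets p h. scaleT (of_int (shuffle_sign n ({..<n} - S)))
      (tensor (ext_prod \<iota> (nths as ({..<p} - S) @ cs)) (ext_prod \<iota> (nths as S @ bs @ cs))))"
    by (rule sum.cong)
      (simp_all add: nths_append_left k_subsets_def p_def n_def del: ext_prod_simps length_append)
  finally show ?thesis .
qed

lemma diamond12_adapted:
  fixes bs cs :: "'v list"
  defines "p \<equiv> length bs" and "n \<equiv> length (bs @ cs)"
  shows "diamond12 scaleE scaleT \<iota> tensor h (tensor (ext_prod \<iota> (as @ cs)) (ext_prod \<iota> (bs @ cs))) =
    (\<Sum>S\<in>k_subsets p h. scaleT (of_int (shuffle_sign n S))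
      (tensor (ext_prod \<iota> (as @ cs @ nths bs S)) (ext_prod \<iota> (nths bs ({..<p} - S) @ cs))))"
proof -
  let ?vs = "bs @ cs"
  have zero: "ext_prod \<iota> (as @ cs @ nths ?vs S) = 0" if "S \<in> k_subsets n h - k_subsets p h" for S
  proof -
    have "\<not> distinct (as @ cs @ nths ?vs S)"
      using that nths_append_meets_right[of S bs cs] by (auto simp: k_subsets_def p_def n_def)
    then show ?thesis
      using ext_prod_nonzero_iff by blast
  qed
  have "diamond12 scaleE scaleT \<iota> tensor h (tensor (ext_prod \<iota> (as @ cs)) (ext_prod \<iota> ?vs)) =
    (\<Sum>S\<in>k_subsets n h. scaleT (of_int (shuffle_sign n S))
      (tensor (ext_prod \<iota> (as @ cs @ nths ?vs S)) (ext_prod \<iota> (nths ?vs ({..<n} - S)))))"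
    unfolding diamond12_well_defined(2) TP.T.slice_sum_k_subsets_left n_def by (simp add: mult.assoc)
  also have "\<dots> = (\<Sum>S\<in>k_subsets p h. scaleT (of_int (shuffle_sign n S))
      (tensor (ext_prod \<iota> (as @ cs @ nths ?vs S)) (ext_prod \<iota> (nths ?vs ({..<n} - S)))))"
  proof (intro sum.mono_neutral_right ballI)
    show "k_subsets p h \<subseteq> k_subsets n h"
      by (auto simp: k_subsets_def p_def n_def)
    show "scaleT (of_int (shuffle_sign n S))
        (tensor (ext_prod \<iota> (as @ cs @ nths ?vs S)) (ext_prod \<iota> (nths ?vs ({..<n} - S)))) = 0"
      if "S \<in> k_subsets n h - k_subsets p h" for S
      by (simp only: zero[OF that] TP.tl.zero TP.T.scale_zero_right)
  qed simp
  also have "\<dots> = (\<Sum>S\<in>k_subsets p h. scaleT (of_int (shuffle_sign n S))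
      (tensor (ext_prod \<iota> (as @ cs @ nths bs S)) (ext_prod \<iota> (nths bs ({..<p} - S) @ cs))))"
    by (rule sum.cong)
      (simp_all add: nths_append_left k_subsets_def p_def n_def del: ext_prod_simps length_append)
  finally show ?thesis .
qed

lemma dual_functional_compl:
  assumes dist: "distinct (as @ ds)" and ind: "V.independent (set (as @ ds))"
    and h: "h \<le> length as" and S0: "S\<^sub>0 \<in> k_subsets (length as) h"
  shows "\<exists>\<phi>. Vector_Spaces.linear scaleE (*) \<phi> \<and>
    (\<forall>S\<in>k_subsets (length as) h.
      \<phi> (ext_prod \<iota> (nths as ({..<length as} - S) @ ds)) = (if S = S\<^sub>0 then 1 else 0))"
proof -
  let ?C = "\<lambda>S. {..<length as} - S"
  have compl: "?C S \<in> k_subsets (length as) (length as - h)" if "S \<in> k_subsets (length as) h" for S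
    using that image_compl_k_subsets[OF h] by blast
  have "?C S = ?C S\<^sub>0 \<longleftrightarrow> S = S\<^sub>0" if "S \<in> k_subsets (length as) h" for S
    using that S0 by (auto simp: k_subsets_def)
  with dual_functional[OF dist ind compl[OF S0]] compl show ?thesis
    by (metis (no_types, lifting))
qed

text \<open>
  The first two parts treat the shape of the first geometric product, the last two the shape of the
  second one, where the tensor factors are exchanged. The spans can be read off because both families
  of factors have dual functionals.
\<close>

lemma tensor_spans_adapted:
  assumes dist: "distinct (as @ ds)" "distinct (as @ cs)"
    and ind: "V.independent (set (as @ ds))" "V.independent (set (as @ cs))"
    and h: "h \<le> length as" and c: "\<And>S. c S \<noteq> 0"
  defines "K \<equiv> k_subsets (length as) h" and "C \<equiv> \<lambda>S. {..<length as} - S"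
  shows "left_span scaleE tensor (\<Sum>S\<in>K. scaleT (c S)
      (tensor (ext_prod \<iota> (nths as (C S) @ cs)) (ext_prod \<iota> (nths as S @ ds)))) =
      E.span ((\<lambda>S. ext_prod \<iota> (nths as S @ cs)) ` k_subsets (length as) (length as - h))"
    and "right_span scaleE tensor (\<Sum>S\<in>K. scaleT (c S)
      (tensor (ext_prod \<iota> (nths as (C S) @ cs)) (ext_prod \<iota> (nths as S @ ds)))) =
      E.span ((\<lambda>S. ext_prod \<iota> (nths as S @ ds)) ` k_subsets (length as) h)"
    and "left_span scaleE tensor (\<Sum>S\<in>K. scaleT (c S)
      (tensor (ext_prod \<iota> (nths as S @ ds)) (ext_prod \<iota> (nths as (C S) @ cs)))) =
      E.span ((\<lambda>S. ext_prod \<iota> (nths as S @ ds)) ` k_subsets (length as) h)"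
    and "right_span scaleE tensor (\<Sum>S\<in>K. scaleT (c S)
      (tensor (ext_prod \<iota> (nths as S @ ds)) (ext_prod \<iota> (nths as (C S) @ cs)))) =
      E.span ((\<lambda>S. ext_prod \<iota> (nths as S @ cs)) ` k_subsets (length as) (length as - h))"
proof -
  have K: "finite K"
    by (simp add: K_def)
  have img: "(\<lambda>S. ext_prod \<iota> (nths as (C S) @ cs)) ` K =
      (\<lambda>S. ext_prod \<iota> (nths as S @ cs)) ` k_subsets (length as) (length as - h)"
    unfolding K_def C_def image_compl_k_subsets[OF h, symmetric] by (simp only: image_image)
  note dual = dual_functional[OF dist(1) ind(1), of _ h, folded K_def]
  note dual_compl = dual_functional_compl[OF dist(2) ind(2) h, folded K_def, folded C_def]
  show "left_span scaleE tensor (\<Sum>S\<in>K. scaleT (c S)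
      (tensor (ext_prod \<iota> (nths as (C S) @ cs)) (ext_prod \<iota> (nths as S @ ds)))) =
      E.span ((\<lambda>S. ext_prod \<iota> (nths as S @ cs)) ` k_subsets (length as) (length as - h))"
    unfolding img[symmetric] by (rule TP.left_span_eq[OF K refl c dual])
  show "right_span scaleE tensor (\<Sum>S\<in>K. scaleT (c S)
      (tensor (ext_prod \<iota> (nths as (C S) @ cs)) (ext_prod \<iota> (nths as S @ ds)))) =
      E.span ((\<lambda>S. ext_prod \<iota> (nths as S @ ds)) ` k_subsets (length as) h)"
    unfolding K_def[symmetric] by (rule TP.right_span_eq[OF K refl c dual_compl])
  show "left_span scaleE tensor (\<Sum>S\<in>K. scaleT (c S)
      (tensor (ext_prod \<iota> (nths as S @ ds)) (ext_prod \<iota> (nths as (C S) @ cs)))) =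
      E.span ((\<lambda>S. ext_prod \<iota> (nths as S @ ds)) ` k_subsets (length as) h)"
    unfolding K_def[symmetric] by (rule TP.left_span_eq[OF K refl c dual_compl])
  show "right_span scaleE tensor (\<Sum>S\<in>K. scaleT (c S)
      (tensor (ext_prod \<iota> (nths as S @ ds)) (ext_prod \<iota> (nths as (C S) @ cs)))) =
      E.span ((\<lambda>S. ext_prod \<iota> (nths as S @ cs)) ` k_subsets (length as) (length as - h))"
    unfolding img[symmetric] by (rule TP.right_span_eq[OF K refl c dual])
qed

lemma diamond21_spans:
  assumes dist: "distinct (as @ bs @ cs)" and ind: "V.independent (set (as @ bs @ cs))"
    and h: "h \<le> length as" and ab: "a \<noteq> 0" "b \<noteq> 0"
  defines "t \<equiv> diamond21 scaleE scaleT \<iota> tensor h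
    (tensor (scaleE a (ext_prod \<iota> (as @ cs))) (scaleE b (ext_prod \<iota> (bs @ cs))))"
  shows "left_span scaleE tensor t =
      E.span ((\<lambda>S. ext_prod \<iota> (nths as S @ cs)) ` k_subsets (length as) (length as - h))"
    and "right_span scaleE tensor t =
      E.span ((\<lambda>S. ext_prod \<iota> (nths as S @ bs @ cs)) ` k_subsets (length as) h)"
proof -
  interpret D: Vector_Spaces.linear scaleT scaleT "diamond21 scaleE scaleT \<iota> tensor h"
    by (rule diamond21_well_defined(1))
  let ?n = "length (as @ cs)"
  have "t = (\<Sum>S\<in>k_subsets (length as) h.
      scaleT (a * b * of_int (shuffle_sign ?n ({..<?n} - S)))
        (tensor (ext_prod \<iota> (nths as ({..<length as} - S) @ cs)) (ext_prod \<iota> (nths as S @ bs @ cs))))"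
    unfolding t_def TP.tl.scale TP.tr.scale D.scale diamond21_adapted
    by (simp add: TP.T.scale_sum_right mult_ac del: ext_prod_simps)
  moreover have "distinct (as @ cs)" "V.independent (set (as @ cs))"
    using dist V.independent_mono[OF ind, of "set (as @ cs)"] by auto
  moreover have "a * b * of_int (shuffle_sign ?n ({..<?n} - S)) \<noteq> 0" for S
    using ab E.of_int_shuffle_sign_nonzero by simp
  ultimately show "left_span scaleE tensor t =
      E.span ((\<lambda>S. ext_prod \<iota> (nths as S @ cs)) ` k_subsets (length as) (length as - h))"
    "right_span scaleE tensor t =
      E.span ((\<lambda>S. ext_prod \<iota> (nths as S @ bs @ cs)) ` k_subsets (length as) h)"
    using tensor_spans_adapted(1,2)[OF dist _ ind _ h] by (simp_all del: ext_prod_simps)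
qed

text \<open>
  Here the vectors of \<open>bs\<close> are multiplied to \<open>A\<close> from the right. Moving them to the front costs a
  sign \<open>s S\<close>, which is absorbed into the coefficients.
\<close>

lemma diamond12_spans:
  assumes dist: "distinct (as @ bs @ cs)" and ind: "V.independent (set (as @ bs @ cs))"
    and h: "h \<le> length bs" and ab: "a \<noteq> 0" "b \<noteq> 0"
  defines "t \<equiv> diamond12 scaleE scaleT \<iota> tensor h
    (tensor (scaleE a (ext_prod \<iota> (as @ cs))) (scaleE b (ext_prod \<iota> (bs @ cs))))"
  shows "left_span scaleE tensor t =
      E.span ((\<lambda>S. ext_prod \<iota> (nths bs S @ as @ cs)) ` k_subsets (length bs) h)"
    and "right_span scaleE tensor t =
      E.span ((\<lambda>S. ext_prod \<iota> (nths bs S @ cs)) ` k_subsets (length bs) (length bs - h))"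
proof -
  interpret D: Vector_Spaces.linear scaleT scaleT "diamond12 scaleE scaleT \<iota> tensor h"
    by (rule diamond12_well_defined(1))
  let ?n = "length (bs @ cs)"
  have "\<exists>s\<in>{1, -1}. ext_prod \<iota> (as @ cs @ nths bs S) = scaleE s (ext_prod \<iota> (nths bs S @ as @ cs))"
    for S
    by (rule ext_prod_permute) simp
  then obtain s where s: "\<And>S. s S \<in> {1, -1}"
    and swap: "\<And>S. ext_prod \<iota> (as @ cs @ nths bs S) = scaleE (s S) (ext_prod \<iota> (nths bs S @ as @ cs))"
    by metis
  have "t = (\<Sum>S\<in>k_subsets (length bs) h.
      scaleT (a * b * of_int (shuffle_sign ?n S) * s S)
        (tensor (ext_prod \<iota> (nths bs S @ as @ cs)) (ext_prod \<iota> (nths bs ({..<length bs} - S) @ cs))))"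
    unfolding t_def TP.tl.scale TP.tr.scale D.scale diamond12_adapted swap
    by (simp add: TP.T.scale_sum_right mult_ac del: ext_prod_simps)
  moreover have "distinct (bs @ as @ cs)" "V.independent (set (bs @ as @ cs))"
    "distinct (bs @ cs)" "V.independent (set (bs @ cs))"
    using dist ind V.independent_mono[OF ind, of "set (bs @ cs)"] by (auto simp: Un_left_commute)
  moreover have "a * b * of_int (shuffle_sign ?n S) * s S \<noteq> 0" for S
    using ab s[of S] E.of_int_shuffle_sign_nonzero by auto
  ultimately show "left_span scaleE tensor t =
      E.span ((\<lambda>S. ext_prod \<iota> (nths bs S @ as @ cs)) ` k_subsets (length bs) h)"
    "right_span scaleE tensor t =
      E.span ((\<lambda>S. ext_prod \<iota> (nths bs S @ cs)) ` k_subsets (length bs) (length bs - h))"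
    using tensor_spans_adapted(3,4)[of bs "as @ cs" cs h] h by (simp_all del: ext_prod_simps)
qed

end

theorem proposition2:
  fixes scaleV :: "'k::field \<Rightarrow> 'v::ab_group_add \<Rightarrow> 'v" and Basis :: "'v set"
    and scaleE :: "'k \<Rightarrow> 'e::ring_1 \<Rightarrow> 'e" and \<iota> :: "'v \<Rightarrow> 'e"
    and scaleT :: "'k \<Rightarrow> 't::ab_group_add \<Rightarrow> 't" and tensor :: "'e \<Rightarrow> 'e \<Rightarrow> 't"
    and A B :: 'e
  assumes "finite_dimensional_vector_space scaleV Basis"
    and "exterior_algebra scaleV scaleE \<iota>"
    and "tensor_product scaleE scaleE scaleT tensor"
    and "extensor scaleE \<iota> A" and "extensor scaleE \<iota> B"
  shows
    "let sp = extensor_space scaleV scaleE \<iota>;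
         dimV = vector_space.dim scaleV;
         spanE = module.span scaleE;
         sumAB = {x + y | x y. x \<in> sp A \<and> y \<in> sp B};
         p = dimV (sp A) - dimV (sp A \<inter> sp B);
         p' = dimV (sp B) - dimV (sp A \<inter> sp B)
     in p = dimV sumAB - dimV (sp B) \<and>
        (\<forall>h\<le>p.
           left_span scaleE tensor (diamond21 scaleE scaleT \<iota> tensor h (tensor A B)) =
             spanE {H. extensor scaleE \<iota> H \<and> sp A \<inter> sp B \<subseteq> sp H \<and> sp H \<subseteq> sp A \<and>
                       dimV (sp A) = dimV (sp H) + h} \<and>
           right_span scaleE tensor (diamond21 scaleE scaleT \<iota> tensor h (tensor A B)) =
             spanE {K. extensor scaleE \<iota> K \<and> sp B \<subseteq> sp K \<and> sp K \<subseteq> sumAB \<and>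
                       dimV (sp K) = dimV (sp B) + h}) \<and>
        (\<forall>h\<le>p'.
           left_span scaleE tensor (diamond12 scaleE scaleT \<iota> tensor h (tensor A B)) =
             spanE {K. extensor scaleE \<iota> K \<and> sp A \<subseteq> sp K \<and> sp K \<subseteq> sumAB \<and>
                       dimV (sp K) = dimV (sp A) + h} \<and>
           right_span scaleE tensor (diamond12 scaleE scaleT \<iota> tensor h (tensor A B)) =
             spanE {H. extensor scaleE \<iota> H \<and> sp A \<inter> sp B \<subseteq> sp H \<and> sp H \<subseteq> sp B \<and>
                       dimV (sp B) = dimV (sp H) + h})"
proof -
  interpret V: finite_dimensional_vector_space scaleV Basis by (rule assms(1))
  interpret exterior_algebra scaleV scaleE \<iota> by (rule assms(2))
  interpret TP: tensor_product scaleE scaleE scaleT tensor by (rule assms(3))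
  interpret exterior_tensor_square scaleV scaleE \<iota> scaleT tensor ..
  let ?sp = "extensor_space scaleV scaleE \<iota>"
  obtain a0 vs where A0: "A = scaleE a0 (ext_prod \<iota> vs)" "a0 \<noteq> 0" "distinct vs"
    "V.independent (set vs)" "?sp A = V.span (set vs)"
    using extensorE[OF assms(4)] by metis
  obtain b0 ws where B0: "B = scaleE b0 (ext_prod \<iota> ws)" "b0 \<noteq> 0" "distinct ws"
    "V.independent (set ws)" "?sp B = V.span (set ws)"
    using extensorE[OF assms(5)] by metis
  have sub: "V.subspace (?sp A)" "V.subspace (?sp B)"
    unfolding A0(5) B0(5) by (rule V.subspace_span)+
  obtain as bs cs where dist: "distinct (as @ bs @ cs)" and ind: "V.independent (set (as @ bs @ cs))"
    and AB: "V.span (set cs) = ?sp A \<inter> ?sp B"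
    and sp: "V.span (set (as @ cs)) = ?sp A" "V.span (set (bs @ cs)) = ?sp B"
    and sum: "V.span (set (as @ bs @ cs)) = {x + y | x y. x \<in> ?sp A \<and> y \<in> ?sp B}"
    by (rule V.adapted_basis[OF sub])
  have dist': "distinct cs" "distinct (as @ cs)" "distinct (bs @ cs)" "distinct (bs @ as @ cs)"
    using dist by auto
  have ind': "V.independent (set cs)" "V.independent (set (as @ cs))"
    "V.independent (set (bs @ cs))" "V.independent (set (bs @ as @ cs))"
    by (rule V.independent_mono[OF ind], fastforce)+
  have dim: "V.dim (?sp A \<inter> ?sp B) = length cs" "V.dim (?sp A) = length as + length cs"
    "V.dim (?sp B) = length bs + length cs"
    "V.dim {x + y | x y. x \<in> ?sp A \<and> y \<in> ?sp B} = length as + length bs + length cs"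
    using V.dim_span_eq_card_independent[OF ind] distinct_card[OF dist]
      V.dim_span_eq_card_independent[OF ind'(1)] distinct_card[OF dist'(1)]
      V.dim_span_eq_card_independent[OF ind'(2)] distinct_card[OF dist'(2)]
      V.dim_span_eq_card_independent[OF ind'(3)] distinct_card[OF dist'(3)]
    unfolding AB sp sum by simp_all
  obtain a where A: "A = scaleE a (ext_prod \<iota> (as @ cs))" "a \<noteq> 0"
  proof -
    obtain d where "d \<noteq> 0" "ext_prod \<iota> vs = scaleE d (ext_prod \<iota> (as @ cs))"
      using ext_prod_proportional[OF dist'(2) ind'(2) A0(3,4)] sp(1) A0(5) by metis
    then show ?thesis
      using that[of "a0 * d"] A0(1,2) by (simp del: ext_prod_simps)
  qed
  obtain b where B: "B = scaleE b (ext_prod \<iota> (bs @ cs))" "b \<noteq> 0"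
  proof -
    obtain d where "d \<noteq> 0" "ext_prod \<iota> ws = scaleE d (ext_prod \<iota> (bs @ cs))"
      using ext_prod_proportional[OF dist'(3) ind'(3) B0(3,4)] sp(2) B0(5) by metis
    then show ?thesis
      using that[of "b0 * d"] B0(1,2) by (simp del: ext_prod_simps)
  qed
  have sum': "V.span (set (bs @ as @ cs)) = {x + y | x y. x \<in> ?sp A \<and> y \<in> ?sp B}"
    unfolding sum[symmetric] by (simp add: Un_left_commute)
  \<comment> \<open>Codimension \<open>h\<close> in a space is turned into a dimension relative to the intersection.\<close>
  have codim: "length as + length cs = d + h \<longleftrightarrow> d = length cs + (length as - h)"
    if "h \<le> length as" for as :: "'v list" and d h
    using that by auto
  note between = span_extensors_between[OF dist ind, unfolded sp sum]
    span_extensors_between[OF dist'(2) ind'(2), unfolded sp AB]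
    span_extensors_between[OF dist'(3) ind'(3), unfolded sp AB]
    span_extensors_between[OF dist'(4) ind'(4), unfolded sp sum']
  show ?thesis
    unfolding Let_def dim
  proof (intro conjI allI impI)
    show "length as + length cs - length cs =
        length as + length bs + length cs - (length bs + length cs)"
      by simp
  next
    fix h assume "h \<le> length as + length cs - length cs"
    then have h: "h \<le> length as"
      by simp
    show "left_span scaleE tensor (diamond21 scaleE scaleT \<iota> tensor h (tensor A B)) =
        E.span {H. extensor scaleE \<iota> H \<and> ?sp A \<inter> ?sp B \<subseteq> ?sp H \<and> ?sp H \<subseteq> ?sp A \<and>
          length as + length cs = V.dim (?sp H) + h}"
      unfolding codim[OF h] between
      unfolding A(1) B(1) by (rule diamond21_spans(1)[OF dist ind h A(2) B(2)])
    show "right_span scaleE tensor (diamond21 scaleE scaleT \<iota> tensor h (tensor A B)) =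
        E.span {K. extensor scaleE \<iota> K \<and> ?sp B \<subseteq> ?sp K \<and>
          ?sp K \<subseteq> {x + y | x y. x \<in> ?sp A \<and> y \<in> ?sp B} \<and>
          V.dim (?sp K) = length bs + length cs + h}"
      unfolding length_append[symmetric] between
      unfolding A(1) B(1) by (rule diamond21_spans(2)[OF dist ind h A(2) B(2)])
  next
    fix h assume "h \<le> length bs + length cs - length cs"
    then have h: "h \<le> length bs"
      by simp
    show "left_span scaleE tensor (diamond12 scaleE scaleT \<iota> tensor h (tensor A B)) =
        E.span {K. extensor scaleE \<iota> K \<and> ?sp A \<subseteq> ?sp K \<and>
          ?sp K \<subseteq> {x + y | x y. x \<in> ?sp A \<and> y \<in> ?sp B} \<and>
          V.dim (?sp K) = length as + length cs + h}"
      unfolding length_append[symmetric] between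
      unfolding A(1) B(1) by (rule diamond12_spans(1)[OF dist ind h A(2) B(2)])
    show "right_span scaleE tensor (diamond12 scaleE scaleT \<iota> tensor h (tensor A B)) =
        E.span {H. extensor scaleE \<iota> H \<and> ?sp A \<inter> ?sp B \<subseteq> ?sp H \<and> ?sp H \<subseteq> ?sp B \<and>
          length bs + length cs = V.dim (?sp H) + h}"
      unfolding codim[OF h] between
      unfolding A(1) B(1) by (rule diamond12_spans(2)[OF dist ind h A(2) B(2)])
  qed
qed

end
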